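(* For a prime $p\ge 5$ let $(t_n)_{n\ge 0}$ be the $(p-3)/2$-periodic binary sequence defined in the context. For any positive integer $s$ and any pattern $\underline{x}=(x_0,\ldots,x_{s-1})\in\{0,1\}^s$ the number $N_s(\underline{x})$ of $n$ with $0\le n\le (p-5)/2$ and $$(t_n,t_{n+1},\ldots,t_{n+s-1})=\underline{x}$$ satisfies $$N_s(\underline{x})=\frac{p}{2^{s+1}}+O\left(sp^{1/2}(\log p)^{s+1}\right).$$
   Context: For a prime $p\ge 5$, let $q_0,q_1,\ldots,q_{(p-3)/2}$ be the (nonzero) quadratic residues modulo $p$, represented as integers in increasing order, $1=q_0<q_1<\cdots<q_{(p-3)/2}\le p-1$. The sequence $(t_n)_{n\ge 0}$ is defined by $t_n=1$ if $q_{n+1}=q_n+1$ and $t_n=0$ if $q_{n+1}\ne q_n+1$, for $n=0,1,\ldots,(p-5)/2$, and is continued periodically by $t_{n+(p-3)/2}=t_n$ for all $n\ge 0$. The notation $f=O(g)$ means $|f|\le c g$ for some absolute constant $c>0$ (here independent of $p$, $s$ and $\underline{x}$). $\log$ is the natural logarithm. *)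

theory Defs
  imports Complex_Main "HOL-Number_Theory.Number_Theory"
begin

definition quad_residues :: "nat \<Rightarrow> int set" where
  "quad_residues p = {a. 1 \<le> a \<and> a \<le> int p - 1 \<and> QuadRes (int p) a}"

(* Meaningful for n < card (quad_residues p), which is (p - 1) div 2 for an odd prime p. *)
definition qr :: "nat \<Rightarrow> nat \<Rightarrow> int" where
  "qr p n = sorted_list_of_set (quad_residues p) ! n"

(* Reducing n modulo the period (p - 3) div 2 gives the periodic continuation from
   the indices 0, ..., (p - 5) div 2. For a prime p \<ge> 5 all divisions by 2 here are exact. *)
definition qr_seq :: "nat \<Rightarrow> nat \<Rightarrow> nat" where
  "qr_seq p n =
     (let m = n mod ((p - 3) div 2)
      in if qr p (m + 1) = qr p m + 1 then 1 else 0)"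

(* Only the values x 0, ..., x (s - 1) of the pattern matter. *)
definition pattern_count :: "nat \<Rightarrow> nat \<Rightarrow> (nat \<Rightarrow> nat) \<Rightarrow> nat" where
  "pattern_count p s x =
     card {n. n \<le> (p - 5) div 2 \<and> (\<forall>i<s. qr_seq p (n + i) = x i)}"

end

theory Submission
  imports Defs "HOL-Computational_Algebra.Polynomial"
begin

text \<open>
  A letter of the sequence tells whether the gap between consecutive quadratic residues is \<open>1\<close> or
  larger. A pattern of length \<open>s\<close> at the index \<open>n\<close> is therefore decided by the \<open>s\<close> gaps after the
  \<open>n\<close>-th residue, and prescribing gaps \<open>d\<^sub>1, \<dots>, d\<^sub>s\<close> means prescribing the residue character of
  \<open>1 + d\<^sub>1 + \<dots> + d\<^sub>s\<close> consecutive integers. If the characters behaved like fair coin tosses, this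
  would happen \<open>p / 2 ^ (1 + d\<^sub>1 + \<dots> + d\<^sub>s)\<close> times. Summing over all gap sequences compatible
  with the pattern, each letter contributes a factor \<open>1/2\<close>: a letter \<open>1\<close> allows only the gap
  \<open>1\<close>, and a letter \<open>0\<close> allows the gaps \<open>2, 3, \<dots>\<close> of total weight \<open>1/4 + 1/8 + \<dots>\<close>. This gives
  the main term \<open>p / 2 ^ (s + 1)\<close>.

  To have few gap sequences, gaps above \<open>K = \<lfloor>ln p\<rfloor>\<close> are treated as exceptional; they are rare, since
  each such gap contains a run of \<open>K\<close> nonresidues. At most \<open>K ^ s\<close> sequences with sum at
  most \<open>s * K\<close> remain, and an error of order \<open>s * K * sqrt p\<close> for each of them adds up to the bound
  of the theorem (\<open>card_positions_near_word_sum\<close> and \<open>word_sum_near_main_term\<close>).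

  That the characters of \<open>W\<close> consecutive integers are independent up to an error of order
  \<open>W * sqrt p\<close> (\<open>residue_word_count_bound\<close>) follows by expanding indicators into products of Legendre
  symbols from a Weil-type bound: a complete sum of a product of \<open>m\<close> Legendre symbols
  of distinct shifts is of order \<open>m * sqrt p\<close> (\<open>Legendre_product_sum_bound\<close>). The implied
  constant must not depend on \<open>m\<close>, as the words grow with \<open>p\<close>.

  This bound is proved by Stepanov's method (\<open>stepanov_degree_bound\<close>). The points where
  \<open>f ^ ((p - 1) div 2)\<close> takes a given value are caught as zeros of high order of a nonzero auxiliary polynomial
  of small degree. Linear algebra provides the polynomial, and it is nonzero because
  \<open>f\<close>, having a simple root, is not a constant times a square (\<open>branches_independent_mod\<close>).
\<close>

section \<open>Zeros of integer polynomials modulo a prime\<close>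

text \<open>
  Polynomials over the field with \<open>p\<close> elements are represented by integer polynomials, where the
  multiples of the constant \<open>[:int p:]\<close> play the part of zero: the prime \<open>p\<close> varies, so no fixed
  type can carry all these fields. Since \<open>[:int p:]\<close> is a prime element, cancellation still works.
\<close>

definition vanishes_mod :: "nat \<Rightarrow> int \<Rightarrow> nat \<Rightarrow> int poly \<Rightarrow> bool" where
  "vanishes_mod p a k h \<longleftrightarrow> (\<exists>u. [:int p:] dvd h - [:-a, 1:] ^ k * u)"

lemma prime_elem_const:
  assumes "prime p"
  shows "prime_elem [:int p:]"
  using assms by (simp add: prime_elem_const_poly_iff prime_imp_prime_elem)

lemma const_dvd_poly:
  assumes "[:c:] dvd h"
  shows "(c::int) dvd poly h a"
proof -
  from assms obtain k where "h = [:c:] * k" by (elim dvdE)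
  then show ?thesis by simp
qed

lemma const_dvd_prime_cancel:
  assumes "prime p" "[:int p:] dvd u * v" "\<not> [:int p:] dvd u"
  shows "[:int p:] dvd v"
  using assms prime_elem_dvd_multD[OF prime_elem_const] by blast

lemma not_const_dvd_linear:
  assumes "prime p"
  shows "\<not> [:int p:] dvd [:-a, 1:] ^ k"
proof
  assume "[:int p:] dvd [:-a, 1:] ^ k"
  then have "[:int p:] dvd [:-a, 1:]"
    using prime_elem_dvd_power[OF prime_elem_const[OF assms]] by blast
  then have "int p dvd coeff [:-a, 1:] 1"
    unfolding const_poly_dvd_iff by blast
  then show False using assms by (simp add: not_prime_unit)
qed

lemma const_dvd_linear_cancel:
  assumes "prime p" "[:int p:] dvd [:-a, 1:] ^ k * v"
  shows "[:int p:] dvd v"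
  using const_dvd_prime_cancel[OF assms] not_const_dvd_linear[OF assms(1)] by blast

lemma root_factor_mod:
  assumes "int p dvd poly h a"
  shows "[:int p:] dvd h - [:-a, 1:] * synthetic_div h a"
proof -
  have "h - [:-a, 1:] * synthetic_div h a = [:poly h a:]"
    using synthetic_div_correct'[of a h] by (metis add_diff_cancel_left')
  then show ?thesis using assms by simp
qed

lemma vanishes_mod_0 [simp]: "vanishes_mod p a 0 h"
  unfolding vanishes_mod_def by (rule exI[of _ h]) simp

lemma vanishes_mod_Suc_imp_root:
  assumes "vanishes_mod p a (Suc k) h"
  shows "int p dvd poly h a"
proof -
  from assms obtain u where "[:int p:] dvd h - [:-a, 1:] ^ Suc k * u"
    unfolding vanishes_mod_def by blast
  from const_dvd_poly[OF this, of a] show ?thesis by simp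
qed

lemma vanishes_mod_cong:
  assumes "[:int p:] dvd h - h'" "vanishes_mod p a k h"
  shows "vanishes_mod p a k h'"
proof -
  from assms(2) obtain u where u: "[:int p:] dvd h - [:-a, 1:] ^ k * u"
    unfolding vanishes_mod_def by blast
  have "h' - [:-a, 1:] ^ k * u = (h - [:-a, 1:] ^ k * u) - (h - h')" by simp
  then show ?thesis unfolding vanishes_mod_def using u assms(1) by (metis dvd_diff)
qed

lemma vanishes_mod_extend:
  assumes "prime p" and u: "[:int p:] dvd h - [:-a, 1:] ^ k * u" and root: "int p dvd poly u a"
  shows "vanishes_mod p a (Suc k) h"
proof -
  let ?v = "synthetic_div u a"
  have "h - [:-a, 1:] ^ Suc k * ?v =
      (h - [:-a, 1:] ^ k * u) + [:-a, 1:] ^ k * (u - [:-a, 1:] * ?v)"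
    by (simp add: algebra_simps)
  moreover have "[:int p:] dvd \<dots>"
    using u root_factor_mod[OF root] by (intro dvd_add dvd_mult)
  ultimately show ?thesis unfolding vanishes_mod_def by metis
qed

lemma vanishes_mod_cancel_same:
  assumes "prime p" "vanishes_mod p a (Suc k) ([:-a, 1:] * h)"
  shows "vanishes_mod p a k h"
proof -
  from assms(2) obtain u where "[:int p:] dvd [:-a, 1:] * h - [:-a, 1:] ^ Suc k * u"
    unfolding vanishes_mod_def by blast
  then have "[:int p:] dvd [:-a, 1:] ^ 1 * (h - [:-a, 1:] ^ k * u)"
    by (simp add: algebra_simps)
  from const_dvd_linear_cancel[OF assms(1) this] show ?thesis
    unfolding vanishes_mod_def by blast
qed

lemma vanishes_mod_cancel_other:
  assumes "prime p" "vanishes_mod p b k ([:-a, 1:] * h)" "\<not> int p dvd b - a"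
  shows "vanishes_mod p b k h"
  using assms(2)
proof (induction k)
  case 0
  show ?case by simp
next
  case (Suc k)
  from Suc.prems obtain w where w: "[:int p:] dvd [:-a, 1:] * h - [:-b, 1:] ^ Suc k * w"
    unfolding vanishes_mod_def by blast
  have "vanishes_mod p b k ([:-a, 1:] * h)"
    unfolding vanishes_mod_def
    by (rule exI[of _ "[:-b, 1:] * w"]) (use w in \<open>simp only: power_Suc mult_ac\<close>)
  from Suc.IH[OF this] obtain v where v: "[:int p:] dvd h - [:-b, 1:] ^ k * v"
    unfolding vanishes_mod_def by blast
  have "[:-b, 1:] ^ k * ([:-a, 1:] * v - [:-b, 1:] * w) =
     ([:-a, 1:] * h - [:-b, 1:] ^ Suc k * w) - [:-a, 1:] * (h - [:-b, 1:] ^ k * v)"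
    by (simp add: algebra_simps)
  moreover have "[:int p:] dvd \<dots>" by (rule dvd_diff[OF w dvd_mult[OF v]])
  ultimately have "[:int p:] dvd [:-a, 1:] * v - [:-b, 1:] * w"
    using const_dvd_linear_cancel[OF assms(1)] by metis
  from const_dvd_poly[OF this, of b] have "int p dvd (b - a) * poly v b"
    by (simp add: left_diff_distrib)
  then have "int p dvd poly v b"
    using assms(1,3) by (metis prime_dvd_mult_iff prime_nat_int_transfer)
  from vanishes_mod_extend[OF assms(1) v this] show ?case .
qed

text \<open>
  Each root can be split off by synthetic division, which lowers the actual degree of the integer
  polynomial by one and its multiplicity at that root by one. The multiplicities at the other
  roots survive because a linear factor that belongs to a different residue can be cancelled.
\<close>

lemma sum_multiplicities_le_degree:
  assumes "prime p" "finite S" "\<And>a b. a \<in> S \<Longrightarrow> b \<in> S \<Longrightarrow> a \<noteq> b \<Longrightarrow> \<not> int p dvd b - a"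
    and "\<not> [:int p:] dvd h" "\<And>a. a \<in> S \<Longrightarrow> vanishes_mod p a (e a) h"
  shows "(\<Sum>a\<in>S. e a) \<le> degree h"
  using assms(4,5)
proof (induction "degree h" arbitrary: h e rule: less_induct)
  case less
  show ?case
  proof (cases "\<forall>a\<in>S. e a = 0")
    case True
    then show ?thesis by simp
  next
    case False
    then obtain a k where a: "a \<in> S" "e a = Suc k" by (meson not0_implies_Suc)
    define u where "u = synthetic_div h a"
    have root: "int p dvd poly h a"
      using less.prems(2)[OF a(1)] a(2) vanishes_mod_Suc_imp_root by simp
    have hu: "[:int p:] dvd h - [:-a, 1:] * u"
      unfolding u_def using root_factor_mod[OF root] .
    have "\<not> [:int p:] dvd u"
      using hu less.prems(1) by (metis diff_add_cancel dvd_add dvd_mult)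
    have pos: "degree h > 0"
    proof (rule ccontr)
      assume "\<not> degree h > 0"
      then obtain c where "h = [:c:]" by (metis degree_eq_zeroE neq0_conv)
      then show False using root less.prems(1) by simp
    qed
    have deg: "degree h = Suc (degree u)"
      using pos by (simp add: u_def degree_synthetic_div)
    have "(\<Sum>b\<in>S. (e(a := k)) b) \<le> degree u"
    proof (rule less.hyps)
      show "degree u < degree h" using deg by simp
      show "\<not> [:int p:] dvd u" by fact
      fix b assume b: "b \<in> S"
      have v: "vanishes_mod p b (e b) ([:-a, 1:] * u)"
        using vanishes_mod_cong[OF hu less.prems(2)[OF b]] .
      show "vanishes_mod p b ((e(a := k)) b) u"
      proof (cases "b = a")
        case True
        have "vanishes_mod p a k u"
          using v unfolding True a(2) by (rule vanishes_mod_cancel_same[OF assms(1)])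
        then show ?thesis using True by simp
      next
        case False
        then have "vanishes_mod p b (e b) u"
          using assms(3)[OF a(1) b] by (intro vanishes_mod_cancel_other[OF assms(1) v]) auto
        then show ?thesis using False by simp
      qed
    qed
    moreover have "(\<Sum>b\<in>S. e b) = Suc (\<Sum>b\<in>S. (e(a := k)) b)"
      using a assms(2) by (simp add: sum.remove)
    ultimately show ?thesis using deg by simp
  qed
qed

lemma const_dvd_pderiv:
  assumes "[:c:] dvd (h :: int poly)"
  shows "[:c:] dvd pderiv h"
  using assms by (auto simp: const_poly_dvd_iff coeff_pderiv)

text \<open>
  Writing \<open>h\<close> as \<open>(X - a) ^ i * u\<close>, the derivative is \<open>i * (X - a) ^ (i - 1) * u\<close> up to
  multiples of \<open>(X - a) ^ i\<close>. As long as \<open>p\<close> does not divide \<open>i\<close>, a zero of order \<open>i\<close> of the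
  derivative therefore forces a further factor \<open>X - a\<close> in \<open>u\<close>.
\<close>

lemma vanishes_mod_from_pderiv:
  assumes "prime p" "k < p" "vanishes_mod p a k (pderiv h)" "int p dvd poly h a"
  shows "vanishes_mod p a (Suc k) h"
proof -
  have "i \<le> Suc k \<Longrightarrow> vanishes_mod p a i h" for i
  proof (induction i)
    case 0
    show ?case by simp
  next
    case (Suc i)
    then obtain u where u: "[:int p:] dvd h - [:-a, 1:] ^ i * u"
      unfolding vanishes_mod_def by auto
    have "int p dvd poly u a"
    proof (cases i)
      case 0
      then have "int p dvd poly (h - u) a" using const_dvd_poly[OF u] by simp
      then show ?thesis using assms(4) by (metis dvd_diff_right_iff poly_diff dvd_add_left_iff diff_add_cancel)
    next
      case (Suc j)
      let ?l = "[:-a, 1:]"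
      from assms(3) obtain w where w: "[:int p:] dvd pderiv h - ?l ^ k * w"
        unfolding vanishes_mod_def by blast
      have "pderiv (?l ^ i * u) = smult (int i) (?l ^ j * u) + ?l ^ i * pderiv u"
        unfolding Suc by (simp add: pderiv_mult pderiv_power_Suc pderiv_pCons algebra_simps del: power_Suc)
      then have "[:int p:] dvd pderiv h - (smult (int i) (?l ^ j * u) + ?l ^ i * pderiv u)"
        using const_dvd_pderiv[OF u] by (simp add: pderiv_diff)
      from dvd_diff[OF w this]
      have d: "[:int p:] dvd smult (int i) (?l ^ j * u) + ?l ^ i * pderiv u - ?l ^ k * w"
        by (simp add: algebra_simps)
      have k: "?l ^ k = ?l ^ j * ?l ^ (k - j)"
        using Suc Suc.prems \<open>Suc i \<le> Suc k\<close> by (simp flip: power_add)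
      have kj: "k - j = Suc (k - i)" using Suc \<open>Suc i \<le> Suc k\<close> by simp
      have "smult (int i) (?l ^ j * u) + ?l ^ i * pderiv u - ?l ^ k * w
          = ?l ^ j * (smult (int i) u + ?l * (pderiv u - ?l ^ (k - i) * w))"
        unfolding k kj unfolding Suc by (simp add: algebra_simps)
      with d have "[:int p:] dvd smult (int i) u + ?l * (pderiv u - ?l ^ (k - i) * w)"
        using const_dvd_linear_cancel[OF assms(1)] by metis
      from const_dvd_poly[OF this, of a] have "int p dvd int i * poly u a" by simp
      moreover have "\<not> int p dvd int i"
        using Suc \<open>Suc i \<le> Suc k\<close> assms(2) by (auto simp: int_dvd_int_iff dest: dvd_imp_le simp del: of_nat_Suc)
      ultimately show ?thesis
        using assms(1) by (metis prime_dvd_mult_iff prime_nat_int_transfer)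
    qed
    then show ?case using vanishes_mod_extend[OF assms(1) u] by simp
  qed
  then show ?thesis by simp
qed

lemma vanishes_mod_from_higher_pderivs:
  assumes "prime p" "l \<le> p" "\<And>k. k < l \<Longrightarrow> int p dvd poly ((pderiv ^^ k) h) a"
  shows "vanishes_mod p a l h"
  using assms(2,3)
proof (induction l arbitrary: h)
  case 0
  show ?case by simp
next
  case (Suc l)
  have "int p dvd poly ((pderiv ^^ k) (pderiv h)) a" if "k < l" for k
    using Suc.prems(2)[of "Suc k"] that by (simp add: funpow_swap1)
  then have "vanishes_mod p a l (pderiv h)"
    using Suc.prems(1) by (intro Suc.IH) auto
  moreover have "l < p" using Suc.prems(1) by simp
  ultimately show ?case
    using vanishes_mod_from_pderiv[OF assms(1)] Suc.prems(2)[of 0] by simp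
qed

section \<open>A polynomial and its half power are independent modulo a prime\<close>

lemma freshmans_dream_mod:
  fixes u v :: "int poly"
  assumes "prime p"
  shows "[:int p:] dvd (u + v) ^ p - (u ^ p + v ^ p)"
proof -
  have p: "p > 0" using assms prime_gt_0_nat by simp
  have "(u + v) ^ p = (\<Sum>k\<le>p. of_nat (p choose k) * u ^ k * v ^ (p - k))"
    by (simp add: binomial_ring)
  also have "{..p} = insert 0 (insert p {1..<p})" using p by auto
  also have "(\<Sum>k\<in>\<dots>. of_nat (p choose k) * u ^ k * v ^ (p - k)) =
      v ^ p + (u ^ p + (\<Sum>k\<in>{1..<p}. of_nat (p choose k) * u ^ k * v ^ (p - k)))"
    using p by simp
  finally have "(u + v) ^ p - (u ^ p + v ^ p) =
     (\<Sum>k\<in>{1..<p}. of_nat (p choose k) * u ^ k * v ^ (p - k))" by simp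
  moreover have "[:int p:] dvd of_nat (p choose k) * u ^ k * v ^ (p - k)" if "k \<in> {1..<p}" for k
  proof -
    have "p dvd (p choose k)"
      using that assms by (intro dvd_choose_prime) auto
    then show ?thesis by (auto simp: of_nat_poly const_poly_dvd_iff int_dvd_int_iff)
  qed
  ultimately show ?thesis by (metis (no_types, lifting) dvd_sum)
qed

text \<open>
  Write \<open>f = a + X * g\<close> and raise to the power \<open>p\<close> termwise.
\<close>

lemma power_prime_mod_monom:
  assumes "prime p"
  obtains F where "[:int p:] dvd f ^ p - ([:coeff f 0 ^ p:] + monom 1 p * F)"
proof -
  obtain a g where f: "f = pCons a g" by (cases f)
  have "f = [:a:] + monom 1 1 * g" unfolding f by (simp add: monom_altdef)
  then have "[:int p:] dvd f ^ p - ([:a:] ^ p + (monom 1 1 * g) ^ p)"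
    using freshmans_dream_mod[OF assms] by metis
  moreover have "[:a:] ^ p + (monom 1 1 * g) ^ p = [:coeff f 0 ^ p:] + monom 1 p * g ^ p"
    by (simp add: f poly_const_pow power_mult_distrib monom_power)
  ultimately show ?thesis using that by metis
qed

text \<open>
  At \<open>\<alpha>\<close> the order of vanishing of \<open>f * r\<^sup>2\<close> is odd and that of \<open>c * s\<^sup>2\<close> is even, so they
  agree only if both are zero. The proof is a descent: a common solution can be divided
  by \<open>X - \<alpha>\<close> in both \<open>r\<close> and \<open>s\<close>.
\<close>

lemma simple_root_not_square_quotient:
  assumes p: "prime p" and f: "f = [:-\<alpha>, 1:] * f1" and f1: "\<not> int p dvd poly f1 \<alpha>"
    and c: "\<not> int p dvd c" and eq: "[:int p:] dvd f * r\<^sup>2 - smult c (s\<^sup>2)"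
  shows "[:int p:] dvd s"
  using eq
proof (induction "degree s" arbitrary: r s rule: less_induct)
  case less
  let ?l = "[:-\<alpha>, 1:]"
  have pint: "prime (int p)" using p by simp
  have dvd2: "int p dvd y" if "int p dvd x * y\<^sup>2" "\<not> int p dvd x" for x y
    using that pint by (meson prime_dvd_mult_iff prime_dvd_power)
  have "int p dvd poly (f * r\<^sup>2 - smult c (s\<^sup>2)) \<alpha>" by (rule const_dvd_poly[OF less.prems])
  then have "int p dvd c * (poly s \<alpha>)\<^sup>2" by (simp add: f)
  then have s\<alpha>: "int p dvd poly s \<alpha>" using dvd2 c by blast
  define s1 where "s1 = synthetic_div s \<alpha>"
  have s: "[:int p:] dvd s - ?l * s1" unfolding s1_def by (rule root_factor_mod[OF s\<alpha>])
  show ?case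
  proof (cases "degree s = 0")
    case True
    then obtain d where "s = [:d:]" by (metis degree_eq_zeroE)
    then show ?thesis using s\<alpha> by simp
  next
    case False
    have "?l * (f1 * r\<^sup>2 - smult c (?l * s1\<^sup>2))
        = (f * r\<^sup>2 - smult c (s\<^sup>2)) + (s - ?l * s1) * (smult c (s + ?l * s1))"
      unfolding f by (simp add: algebra_simps power2_eq_square smult_add_right smult_diff_right)
    moreover have "[:int p:] dvd \<dots>" by (rule dvd_add[OF less.prems dvd_mult2[OF s]])
    ultimately have 1: "[:int p:] dvd f1 * r\<^sup>2 - smult c (?l * s1\<^sup>2)"
      using const_dvd_linear_cancel[OF p, of \<alpha> 1] by (metis power_one_right)
    from const_dvd_poly[OF this, of \<alpha>] have "int p dvd poly f1 \<alpha> * (poly r \<alpha>)\<^sup>2" by simp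
    then have r\<alpha>: "int p dvd poly r \<alpha>" using dvd2 f1 by blast
    define r1 where "r1 = synthetic_div r \<alpha>"
    have r: "[:int p:] dvd r - ?l * r1" unfolding r1_def by (rule root_factor_mod[OF r\<alpha>])
    have "?l * (f * r1\<^sup>2 - smult c (s1\<^sup>2))
        = (f1 * r\<^sup>2 - smult c (?l * s1\<^sup>2)) - (r - ?l * r1) * (f1 * (r + ?l * r1))"
      unfolding f by (simp add: algebra_simps power2_eq_square smult_add_right smult_diff_right)
    moreover have "[:int p:] dvd \<dots>" by (rule dvd_diff[OF 1 dvd_mult2[OF r]])
    ultimately have "[:int p:] dvd f * r1\<^sup>2 - smult c (s1\<^sup>2)"
      using const_dvd_linear_cancel[OF p, of \<alpha> 1] by (metis power_one_right)
    moreover have "degree s1 < degree s" using False by (simp add: s1_def degree_synthetic_div)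
    ultimately have "[:int p:] dvd s1" using less.hyps by blast
    then show ?thesis using s by (metis diff_add_cancel dvd_add dvd_mult)
  qed
qed

text \<open>
  This is what keeps the auxiliary polynomial from being zero; \<open>g\<close> stands for
  \<open>f ^ ((p - 1) div 2)\<close>. Multiplying the relation \<open>u + g * v = 0\<close> by its conjugate \<open>u - g * v\<close>
  and by \<open>f\<close> gives \<open>f * u\<^sup>2 = f ^ p * v\<^sup>2\<close>, and \<open>f ^ p\<close> is the constant
  \<open>f(0) ^ p\<close> up to multiples of \<open>X ^ p\<close>. The terms of degree below \<open>p\<close> say that
  \<open>f * R\<^sub>0\<^sup>2 = c * S\<^sub>0\<^sup>2\<close>, which is impossible because \<open>f\<close> has a simple root, unless both
  vanish. Then the relation is divisible by \<open>X ^ p\<close>, and induction applies.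
\<close>

lemma branches_independent_mod:
  assumes p: "prime p" and f: "f = [:-\<alpha>, 1:] * f1" and f1: "\<not> int p dvd poly f1 \<alpha>"
    and f0: "\<not> int p dvd coeff f 0" and g: "f * g\<^sup>2 = f ^ p"
    and "\<And>j. j < J \<Longrightarrow> degree f + 2 * degree (R j) < p" "\<And>j. j < J \<Longrightarrow> 2 * degree (S j) < p"
    and "[:int p:] dvd (\<Sum>j<J. R j * monom 1 (j * p)) + g * (\<Sum>j<J. S j * monom 1 (j * p))"
    and "j < J"
  shows "[:int p:] dvd R j \<and> [:int p:] dvd S j"
  using assms(6-9)
proof (induction J arbitrary: R S j)
  case 0
  then show ?case by simp
next
  case (Suc J)
  let ?P = "[:int p:]" and ?X = "monom (1::int) p"
  have pint: "prime (int p)" using p by simp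
  define U where "U = (\<Sum>j<J. R (Suc j) * monom 1 (j * p))"
  define V where "V = (\<Sum>j<J. S (Suc j) * monom 1 (j * p))"
  have shift: "(\<Sum>j<Suc J. T j * monom 1 (j * p)) = T 0 + ?X * (\<Sum>j<J. T (Suc j) * monom 1 (j * p))"
    for T :: "nat \<Rightarrow> int poly"
    unfolding sum.lessThan_Suc_shift sum_distrib_left
    by (auto intro!: sum.cong simp: mult_monom algebra_simps)
  have dvd: "?P dvd (R 0 + ?X * U) + g * (S 0 + ?X * V)"
    using Suc.prems(3) unfolding shift U_def V_def .
  obtain F where F: "?P dvd f ^ p - ([:coeff f 0 ^ p:] + ?X * F)"
    using power_prime_mod_monom[OF p] .
  define c where "c = coeff f 0 ^ p"
  have c: "\<not> int p dvd c" using f0 pint prime_dvd_power unfolding c_def by blast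
  \<comment> \<open>With \<open>u = R 0 + X ^ p * U\<close> and \<open>v = S 0 + X ^ p * V\<close>, \<open>?E\<close> contains the terms
    of degree below \<open>p\<close> of \<open>f * u\<^sup>2 - f ^ p * v\<^sup>2\<close>, and \<open>?Z\<close> what is multiplied by \<open>X ^ p\<close>.\<close>
  let ?E = "f * (R 0)\<^sup>2 - smult c ((S 0)\<^sup>2)"
  let ?Z = "f * (2 * R 0 * U + ?X * U\<^sup>2) - F * (S 0 + ?X * V)\<^sup>2 - smult c (2 * S 0 * V + ?X * V\<^sup>2)"
  have cs: "smult c y = [:c:] * y" for y by simp
  have "?E + ?X * ?Z = f * (R 0 + ?X * U)\<^sup>2 - ([:c:] + ?X * F) * (S 0 + ?X * V)\<^sup>2"
    unfolding cs by (simp only: algebra_simps power2_eq_square)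
  also have "\<dots> = f * (((R 0 + ?X * U) + g * (S 0 + ?X * V)) * ((R 0 + ?X * U) - g * (S 0 + ?X * V)))
       + (f ^ p - ([:c:] + ?X * F)) * (S 0 + ?X * V)\<^sup>2"
    unfolding g[symmetric] by (simp only: algebra_simps power2_eq_square)
  finally have eq: "?E + ?X * ?Z = \<dots>" .
  have E: "?P dvd ?E + ?X * ?Z"
    unfolding eq by (rule dvd_add[OF dvd_mult[OF dvd_mult2[OF dvd]] dvd_mult2[OF F[folded c_def]]])
  have "degree ?E < p"
  proof -
    have "degree ((R 0)\<^sup>2) \<le> 2 * degree (R 0)" "degree ((S 0)\<^sup>2) \<le> 2 * degree (S 0)"
      using degree_power_le by (metis mult.commute)+
    then have "degree (f * (R 0)\<^sup>2) < p" "degree (smult c ((S 0)\<^sup>2)) < p"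
      using Suc.prems(1)[of 0] Suc.prems(2)[of 0] degree_mult_le[of f "(R 0)\<^sup>2"]
        degree_smult_le[of c "(S 0)\<^sup>2"] by linarith+
    then show ?thesis by (rule degree_diff_less)
  qed
  have "?P dvd ?E"
    unfolding const_poly_dvd_iff
  proof
    fix i
    show "int p dvd coeff ?E i"
    proof (cases "i < p")
      case True
      then have "coeff (?E + ?X * ?Z) i = coeff ?E i" by (simp add: coeff_monom_mult)
      then show ?thesis using E unfolding const_poly_dvd_iff by metis
    next
      case False
      then have "coeff ?E i = 0" using \<open>degree ?E < p\<close> by (intro coeff_eq_0) simp
      then show ?thesis by simp
    qed
  qed
  then have S0: "?P dvd S 0" using simple_root_not_square_quotient[OF p f f1 c] by blast
  have fP: "\<not> ?P dvd f" using f0 unfolding const_poly_dvd_iff by blast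
  have "?P dvd smult c ((S 0)\<^sup>2)" using S0 by (simp add: dvd_smult power2_eq_square)
  with \<open>?P dvd ?E\<close> have "?P dvd f * (R 0)\<^sup>2" by (metis diff_add_cancel dvd_add)
  then have R0: "?P dvd R 0"
    using const_dvd_prime_cancel[OF p _ fP] prime_elem_dvd_power[OF prime_elem_const[OF p]] by blast
  have "?X * (U + g * V) = ((R 0 + ?X * U) + g * (S 0 + ?X * V)) - (R 0 + g * S 0)"
    by (simp add: algebra_simps)
  moreover have "?P dvd \<dots>" by (rule dvd_diff[OF dvd dvd_add[OF R0 dvd_mult[OF S0]]])
  ultimately have XUV: "?P dvd ?X * (U + g * V)" by (simp only:)
  have "\<not> ?P dvd ?X"
  proof
    assume "?P dvd ?X"
    then have "int p dvd coeff ?X p" unfolding const_poly_dvd_iff by blast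
    then show False using p by (simp add: not_prime_unit)
  qed
  then have UV: "?P dvd U + g * V" using const_dvd_prime_cancel[OF p XUV] by blast
  show ?case
  proof (cases j)
    case 0
    then show ?thesis using R0 S0 by simp
  next
    case (Suc i)
    have "?P dvd R (Suc i) \<and> ?P dvd S (Suc i)"
      by (rule Suc.IH[of "\<lambda>j. R (Suc j)" "\<lambda>j. S (Suc j)"])
        (use Suc Suc.prems UV in \<open>auto simp: U_def V_def\<close>)
    then show ?thesis using Suc by simp
  qed
qed

section \<open>Iterated derivatives\<close>

text \<open>
  Each derivative of \<open>f ^ n * u\<close> costs only one factor \<open>f\<close>; this is the other factor, whose degree
  grows by at most \<open>degree f\<close> per step even though \<open>n\<close> may be large.
\<close>

primrec pderiv_cofactor :: "int poly \<Rightarrow> nat \<Rightarrow> nat \<Rightarrow> int poly \<Rightarrow> int poly" where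
  "pderiv_cofactor f n 0 u = u"
| "pderiv_cofactor f n (Suc k) u =
    smult (int (n - k)) (pderiv f * pderiv_cofactor f n k u) + f * pderiv (pderiv_cofactor f n k u)"

lemma higher_pderiv_power_mult:
  "k \<le> n \<Longrightarrow> (pderiv ^^ k) (f ^ n * u) = f ^ (n - k) * pderiv_cofactor f n k u"
proof (induction k)
  case 0
  show ?case by simp
next
  case (Suc k)
  then obtain j where j: "n - k = Suc j" "n - Suc k = j" by (metis Suc_diff_Suc Suc_le_lessD)
  have "(pderiv ^^ Suc k) (f ^ n * u) = pderiv (f ^ Suc j * pderiv_cofactor f n k u)"
    using Suc j by simp
  also have "\<dots> = f ^ j * pderiv_cofactor f n (Suc k) u"
    by (simp add: pderiv_mult pderiv_power_Suc j algebra_simps smult_add_left del: of_nat_Suc power_Suc) (simp add: mult_ac)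
  finally show ?case using j by simp
qed

lemma degree_pderiv_cofactor: "degree (pderiv_cofactor f n k u) \<le> degree u + k * degree f"
proof (induction k)
  case 0
  show ?case by simp
next
  case (Suc k)
  let ?v = "pderiv_cofactor f n k u"
  have "degree (pderiv f * ?v) \<le> degree f + degree ?v"
    using degree_mult_le[of "pderiv f" ?v] by (simp add: degree_pderiv)
  moreover have "degree (f * pderiv ?v) \<le> degree f + degree ?v"
    using degree_mult_le[of f "pderiv ?v"] by (simp add: degree_pderiv)
  ultimately have "degree (pderiv_cofactor f n (Suc k) u) \<le> degree f + degree ?v"
    using degree_smult_le order_trans by (auto intro!: degree_add_le)
  then show ?case using Suc by simp
qed

text \<open>
  Powers of \<open>X ^ p\<close> are constants for the derivation modulo \<open>p\<close>.
\<close>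

lemma pderiv_monom_mult_prime:
  "[:int p:] dvd pderiv (v * monom 1 (j * p)) - pderiv v * monom 1 (j * p)"
proof -
  have "pderiv (v * monom 1 (j * p)) - pderiv v * monom 1 (j * p)
      = [:int p:] * (v * monom (int j) (j * p - 1))"
    by (simp add: pderiv_mult pderiv_monom smult_monom flip: mult_smult_right)
  then show ?thesis by (metis dvd_triv_left)
qed

lemma higher_pderiv_monom_mult_prime:
  "[:int p:] dvd (pderiv ^^ k) (v * monom 1 (j * p)) - (pderiv ^^ k) v * monom 1 (j * p)"
proof (induction k)
  case 0
  show ?case by simp
next
  case (Suc k)
  let ?X = "monom (1::int) (j * p)"
  have "(pderiv ^^ Suc k) (v * ?X) - (pderiv ^^ Suc k) v * ?X
     = pderiv ((pderiv ^^ k) (v * ?X) - (pderiv ^^ k) v * ?X)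
       + (pderiv ((pderiv ^^ k) v * ?X) - pderiv ((pderiv ^^ k) v) * ?X)"
    by (simp add: pderiv_diff)
  moreover have "[:int p:] dvd \<dots>"
    by (rule dvd_add[OF const_dvd_pderiv[OF Suc] pderiv_monom_mult_prime])
  ultimately show ?case by metis
qed

section \<open>Stepanov's bound\<close>

text \<open>
  With more unknowns than equations, two of the \<open>p ^ card I\<close> vectors of residues have the same
  image by the pigeonhole principle, and their difference is the solution.
\<close>

lemma homogeneous_system_mod_prime:
  fixes M :: "'e \<Rightarrow> 'i \<Rightarrow> int"
  assumes "prime p" "finite I" "finite E" "card E < card I"
  obtains c where "\<exists>i\<in>I. \<not> int p dvd c i" "\<And>e. e \<in> E \<Longrightarrow> int p dvd (\<Sum>i\<in>I. c i * M e i)"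
proof -
  define A where "A = PiE I (\<lambda>_. {0..<int p})"
  define Y where "Y = PiE E (\<lambda>_. {0..<int p})"
  define \<Phi> where "\<Phi> c = restrict (\<lambda>e. (\<Sum>i\<in>I. c i * M e i) mod int p) E" for c
  have p: "p > 1" by (rule prime_gt_1_nat[OF assms(1)])
  have "\<Phi> ` A \<subseteq> Y" using p unfolding \<Phi>_def Y_def by auto
  moreover have "finite Y" unfolding Y_def using assms(3) by (intro finite_PiE) auto
  ultimately have "card (\<Phi> ` A) \<le> card Y" by (meson card_mono)
  also have "\<dots> = p ^ card E" unfolding Y_def using assms(3) by (simp add: card_PiE)
  also have "\<dots> < p ^ card I" using p assms(4) by simp
  also have "\<dots> = card A" unfolding A_def using assms(2) by (simp add: card_PiE)
  finally have "\<not> inj_on \<Phi> A" by (rule pigeonhole)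
  then obtain a b where ab: "a \<in> A" "b \<in> A" "\<Phi> a = \<Phi> b" "a \<noteq> b" unfolding inj_on_def by blast
  show ?thesis
  proof (rule that[of "\<lambda>i. a i - b i"])
    obtain i where i: "i \<in> I" "a i \<noteq> b i"
      using ab unfolding A_def by (metis PiE_ext)
    have "a i \<in> {0..<int p}" "b i \<in> {0..<int p}" using ab i unfolding A_def by auto
    then have "\<not> int p dvd a i - b i"
      using i(2) by (metis atLeastLessThan_iff mod_eq_dvd_iff mod_pos_pos_trivial)
    then show "\<exists>i\<in>I. \<not> int p dvd a i - b i" using i(1) by blast
    fix e assume "e \<in> E"
    then have "(\<Sum>i\<in>I. a i * M e i) mod int p = (\<Sum>i\<in>I. b i * M e i) mod int p"
      using fun_cong[OF ab(3), of e] unfolding \<Phi>_def by simp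
    then show "int p dvd (\<Sum>i\<in>I. (a i - b i) * M e i)"
      by (simp add: mod_eq_dvd_iff left_diff_distrib sum_subtractf)
  qed
qed

text \<open>
  Stepanov's method. Consider the polynomials
  \<open>H = (\<Sum>(b, j, i). c (b, j, i) * f ^ (l + b * q) * X ^ i * X ^ (j * p))\<close> with \<open>b < 2\<close>,
  \<open>j < J\<close>, \<open>i < B\<close>. At a point \<open>a\<close> with \<open>f(a) ^ q = \<epsilon>\<close> one may replace \<open>f ^ q\<close> by \<open>\<epsilon>\<close> and
  \<open>X ^ p\<close> by \<open>X\<close> in every derivative, so the \<open>k\<close>-th derivative vanishes at all these points as
  soon as one polynomial \<open>Q k\<close>, of degree only about \<open>B + k * m + J\<close>, is zero. These are
  fewer than \<open>2 * B * J\<close> linear conditions on the coefficients, so a nontrivial choice of \<open>c\<close> makes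
  \<open>H\<close> vanish to order \<open>l\<close> at each of the points. As \<open>H\<close> itself is not zero, its degree bounds
  \<open>l\<close> times the number of points.
\<close>

lemma stepanov_degree_bound:
  assumes p: "prime p" "p = 2 * q + 1" and f: "f = [:-\<alpha>, 1:] * f1"
    and f1: "\<not> int p dvd poly f1 \<alpha>" and f0: "\<not> int p dvd coeff f 0"
    and m: "degree f = m" "m + 2 * B \<le> p + 1"
    and l: "l \<le> p" "l * (B + l * m + J) < 2 * B * J"
  shows "l * card {a \<in> {0..<int p}. int p dvd poly f a ^ q - \<epsilon>} \<le> m * (l + q) + B + J * p"
proof -
  let ?P = "[:int p:]"
  let ?S = "{a \<in> {0..<int p}. int p dvd poly f a ^ q - \<epsilon>}"
  define I where "I = {..<2::nat} \<times> {..<J} \<times> {..<B}"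
  define E where "E = {..<l} \<times> {..<B + l * m + J}"
  define W where "W b k i = pderiv_cofactor f (l + b * q) k (monom 1 i)" for b k i
  \<comment> \<open>\<open>Q k\<close> is the \<open>k\<close>-th derivative of a term, up to the factor \<open>f ^ (l - k)\<close>, after replacing
    \<open>f ^ q\<close> by \<open>\<epsilon>\<close> and \<open>X ^ p\<close> by \<open>X\<close>.\<close>
  define Q where "Q k = (\<lambda>(b, j, i). smult (\<epsilon> ^ b) (W b k i * monom 1 j))" for k
  have "card E < card I" using l(2) by (simp add: E_def I_def algebra_simps)
  have finI: "finite I" and finE: "finite E" by (simp_all add: I_def E_def)
  obtain c where c_nz: "\<exists>x\<in>I. \<not> int p dvd c x"
    and c: "\<And>e. e \<in> E \<Longrightarrow> int p dvd (\<Sum>x\<in>I. c x * coeff (Q (fst e) x) (snd e))"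
    using homogeneous_system_mod_prime[OF p(1) finI finE \<open>card E < card I\<close>,
        of "\<lambda>e x. coeff (Q (fst e) x) (snd e)"] by blast
  define h where "h = (\<lambda>(b, j, i). f ^ (l + b * q) * monom 1 i * monom (1::int) (j * p))"
  define H where "H = (\<Sum>x\<in>I. smult (c x) (h x))"

  have degQ: "degree (Q k x) < B + l * m + J" if k: "k < l" and x: "x \<in> I" for k x
  proof -
    obtain b j i where x': "x = (b, j, i)" "j < J" "i < B" using x by (auto simp: I_def)
    have "degree (W b k i) \<le> i + k * m"
      using degree_pderiv_cofactor[of f "l + b * q" k "monom 1 i"] m(1)
      by (simp add: W_def degree_monom_eq)
    then have "degree (W b k i * monom 1 j) \<le> i + k * m + j"
      using degree_mult_le[of "W b k i" "monom 1 j"] by (simp add: degree_monom_eq)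
    moreover have "k * m \<le> l * m" using k by simp
    ultimately have "degree (W b k i * monom 1 j) < B + l * m + J" using x' by linarith
    then show ?thesis
      unfolding Q_def x'(1) using degree_smult_le[of "\<epsilon> ^ b" "W b k i * monom 1 j"] by simp
  qed
  have Q0: "?P dvd (\<Sum>x\<in>I. smult (c x) (Q k x))" if k: "k < l" for k
    unfolding const_poly_dvd_iff
  proof
    fix d
    show "int p dvd coeff (\<Sum>x\<in>I. smult (c x) (Q k x)) d"
    proof (cases "d < B + l * m + J")
      case True
      then show ?thesis using c[of "(k, d)"] k by (simp add: E_def coeff_sum)
    next
      case False
      then have "coeff (Q k x) d = 0" if "x \<in> I" for x
        using degQ[OF k that] by (intro coeff_eq_0) simp
      then show ?thesis by (simp add: coeff_sum)
    qed
  qed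

  have pd_sum: "(pderiv ^^ k) H = (\<Sum>x\<in>I. smult (c x) ((pderiv ^^ k) (h x)))" for k
    by (simp add: H_def higher_pderiv_sum higher_pderiv_smult)
  have vanish: "vanishes_mod p a l H" if a: "a \<in> ?S" for a
  proof (rule vanishes_mod_from_higher_pderivs[OF p(1) l(1)])
    fix k assume k: "k < l"
    have frob: "[a ^ p = a] (mod int p)"
    proof (cases "a = 0")
      case True
      then show ?thesis using p by simp
    next
      case False
      then obtain n where n: "a = int n" "0 < n" "n < p" using a by (auto dest: zero_le_imp_eq_int)
      then have "\<not> p dvd n" by (auto dest: dvd_imp_le)
      then have "[n ^ (p - 1) * n = 1 * n] (mod p)"
        using fermat_theorem[OF p(1)] by (intro cong_mult cong_refl)
      then have "[n ^ p = n] (mod p)" using p(2) by (simp add: mult.commute)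
      then show ?thesis unfolding n(1) by (simp flip: cong_int_iff)
    qed
    have \<epsilon>: "[poly f a ^ q = \<epsilon>] (mod int p)" using a by (simp add: cong_iff_dvd_diff)
    have summand: "[poly ((pderiv ^^ k) (h x)) a = poly f a ^ (l - k) * poly (Q k x) a] (mod int p)"
      if x: "x \<in> I" for x
    proof -
      obtain b j i where x': "x = (b, j, i)" using prod_cases3 by blast
      define u where "u = f ^ (l + b * q) * monom (1::int) i"
      have hx: "h x = u * monom 1 (j * p)" by (simp add: h_def x' u_def)
      have pu: "(pderiv ^^ k) u = f ^ (l - k) * f ^ (b * q) * W b k i"
        using k by (simp add: u_def higher_pderiv_power_mult W_def flip: power_add)
      have "int p dvd poly ((pderiv ^^ k) (h x) - (pderiv ^^ k) u * monom 1 (j * p)) a"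
        unfolding hx by (rule const_dvd_poly[OF higher_pderiv_monom_mult_prime])
      then have "[poly ((pderiv ^^ k) (h x)) a =
          poly f a ^ (l - k) * (poly f a ^ q) ^ b * poly (W b k i) a * (a ^ p) ^ j] (mod int p)"
        by (simp add: pu poly_monom cong_iff_dvd_diff poly_power mult.commute flip: power_mult)
      also have "[poly f a ^ (l - k) * (poly f a ^ q) ^ b * poly (W b k i) a * (a ^ p) ^ j
          = poly f a ^ (l - k) * \<epsilon> ^ b * poly (W b k i) a * a ^ j] (mod int p)"
        by (intro cong_mult cong_pow cong_refl \<epsilon> frob)
      also have "poly f a ^ (l - k) * \<epsilon> ^ b * poly (W b k i) a * a ^ j
          = poly f a ^ (l - k) * poly (Q k x) a"
        by (simp add: Q_def x' poly_monom)
      finally show ?thesis .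
    qed
    have "[poly ((pderiv ^^ k) H) a = (\<Sum>x\<in>I. c x * (poly f a ^ (l - k) * poly (Q k x) a))] (mod int p)"
      unfolding pd_sum poly_sum poly_smult by (intro cong_sum cong_mult cong_refl summand)
    also have "(\<Sum>x\<in>I. c x * (poly f a ^ (l - k) * poly (Q k x) a))
        = poly f a ^ (l - k) * poly (\<Sum>x\<in>I. smult (c x) (Q k x)) a"
      by (simp add: poly_sum sum_distrib_left mult_ac)
    finally show "int p dvd poly ((pderiv ^^ k) H) a"
      using const_dvd_poly[OF Q0[OF k], of a] by (metis cong_dvd_iff dvd_mult)
  qed

  have H_nz: "\<not> ?P dvd H"
  proof
    assume dvd: "?P dvd H"
    define R where "R b j = (\<Sum>i<B. monom (c (b, j, i)) i)" for b j
    have degR: "degree (R b j) \<le> B - 1" for b j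
      unfolding R_def by (rule degree_sum_le) (auto intro: order_trans[OF degree_monom_le])
    have coeffR: "coeff (R b j) i = c (b, j, i)" if "i < B" for b j i
      using that by (simp add: R_def coeff_sum)
    have sub: "(\<Sum>i<B. smult (c (b, j, i)) (h (b, j, i)))
        = f ^ l * (f ^ (b * q) * (R b j * monom 1 (j * p)))" for b j
    proof -
      have mon: "monom (c x) i = smult (c x) (monom 1 i)" for x i by (simp add: smult_monom)
      show ?thesis
        unfolding R_def h_def mon sum_distrib_left sum_distrib_right
        by (intro sum.cong refl) (simp add: power_add mult.assoc)
    qed
    have "H = (\<Sum>b<2. \<Sum>j<J. \<Sum>i<B. smult (c (b, j, i)) (h (b, j, i)))"
      unfolding H_def I_def by (simp add: sum.cartesian_product case_prod_unfold)
    also have "\<dots> = f ^ l * ((\<Sum>j<J. R 0 j * monom 1 (j * p)) + f ^ q * (\<Sum>j<J. R 1 j * monom 1 (j * p)))"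
      unfolding sub by (simp add: numeral_2_eq_2 sum_distrib_left ring_distribs)
    finally have H: "H = \<dots>" .
    have "\<not> ?P dvd f" using f0 unfolding const_poly_dvd_iff by blast
    then have "\<not> ?P dvd f ^ l"
      using prime_elem_dvd_power[OF prime_elem_const[OF p(1)]] by blast
    then have "?P dvd (\<Sum>j<J. R 0 j * monom 1 (j * p)) + f ^ q * (\<Sum>j<J. R 1 j * monom 1 (j * p))"
      using const_dvd_prime_cancel[OF p(1)] dvd unfolding H by blast
    moreover have "f * (f ^ q)\<^sup>2 = f ^ p"
      unfolding p(2) by (simp add: power_mult mult.commute)
    moreover obtain b0 j0 i0 where x: "b0 < 2" "j0 < J" "i0 < B" "\<not> int p dvd c (b0, j0, i0)"
      using c_nz by (auto simp: I_def)
    moreover have "m + 2 * degree (R b j) < p" for b j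
      using degR[of b j] m x(3) by linarith
    ultimately have "?P dvd R 0 j0 \<and> ?P dvd R 1 j0"
      using branches_independent_mod[OF p(1) f f1 f0, of "f ^ q" J "R 0" "R 1" j0] m(1)
      by (metis add_leD2 le_less_trans less_imp_le_nat order_refl add.commute le_add2)
    then have "?P dvd R b0 j0" using x(1) by (auto simp: less_2_cases_iff)
    then have "int p dvd coeff (R b0 j0) i0" unfolding const_poly_dvd_iff by blast
    then show False using coeffR x by simp
  qed

  have "degree (h x) \<le> m * (l + q) + B + J * p" if x: "x \<in> I" for x
  proof -
    obtain b j i where x': "x = (b, j, i)" "b < 2" "j < J" "i < B" using x by (auto simp: I_def)
    have "degree (f ^ (l + b * q)) \<le> m * (l + b * q)"
      using degree_power_le[of f "l + b * q"] m(1) by simp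
    also have "\<dots> \<le> m * (l + q)" using x'(2) by (intro mult_le_mono2) (auto simp: less_2_cases_iff)
    finally have "degree (f ^ (l + b * q)) \<le> m * (l + q)" .
    moreover have "j * p \<le> J * p" using x'(3) by simp
    moreover have "degree (h x) \<le> degree (f ^ (l + b * q)) + i + j * p"
      unfolding h_def x'(1) prod.case
      using degree_mult_le[of "f ^ (l + b * q)" "monom 1 i"]
        degree_mult_le[of "f ^ (l + b * q) * monom 1 i" "monom 1 (j * p)"]
      by (simp add: degree_monom_eq)
    ultimately show ?thesis using x'(4) by linarith
  qed
  then have "degree H \<le> m * (l + q) + B + J * p"
    unfolding H_def by (intro degree_sum_le[OF finI] order_trans[OF degree_smult_le]) auto
  moreover have "(\<Sum>a\<in>?S. l) \<le> degree H"
  proof (rule sum_multiplicities_le_degree[OF p(1) _ _ H_nz vanish])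
    show "finite ?S" by (rule finite_subset[of _ "{0..<int p}"]) auto
    fix a b assume ab: "a \<in> ?S" "b \<in> ?S" "a \<noteq> b"
    then show "\<not> int p dvd b - a"
      by (metis (no_types, lifting) atLeastLessThan_iff mem_Collect_eq mod_eq_dvd_iff mod_pos_pos_trivial)
  qed
  ultimately show ?thesis by (simp add: mult.commute)
qed

text \<open>
  The main term \<open>p / 2\<close> arises because about \<open>B = p / 2\<close> and two branches give \<open>p * J\<close> unknowns,
  against roughly \<open>l * p / 2\<close> equations: \<open>J\<close> just above \<open>l / 2\<close> suffices, while the degree is
  about \<open>p * J\<close>. An order \<open>l\<close> of the size of the square root of \<open>p\<close> balances the two error terms.
  The linear dependence on \<open>m\<close>, with an absolute constant, is essential for the application, where
  the degree grows with \<open>p\<close>.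
\<close>

lemma power_residue_count_le:
  fixes f :: "int poly" and m :: nat
  assumes p: "prime p" "p > 2" and f: "f = [:-\<alpha>, 1:] * f1"
    and f1: "\<not> int p dvd poly f1 \<alpha>" and f0: "\<not> int p dvd coeff f 0" and m: "degree f = m" "m > 0"
  shows "real (card {a \<in> {0..<int p}. int p dvd poly f a ^ ((p - 1) div 2) - \<epsilon>})
    \<le> p / 2 + 22 * m * sqrt p" (is "real ?N \<le> _")
proof -
  have N: "real ?N \<le> p"
  proof -
    have "?N \<le> card {0..<int p}" by (intro card_mono) auto
    then show ?thesis by simp
  qed
  have m1: "real m \<ge> 1" using m(2) by simp
  have sq: "sqrt p * sqrt p = p" "sqrt p \<ge> 1" using p(2) by simp_all
  \<comment> \<open>For small \<open>p\<close> and for large degree the number \<open>p\<close> of all points is already within the bound.\<close>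
  consider "p < 256" | "p < 4 * m" | "p \<ge> 256" "4 * m \<le> p" by linarith
  then show ?thesis
  proof cases
    case 1
    then have "sqrt p < 16" by (intro real_less_lsqrt) auto
    then have "sqrt p * sqrt p \<le> 16 * sqrt p" by (intro mult_right_mono) auto
    also have "\<dots> \<le> 22 * m * sqrt p" using m1 sq by (intro mult_right_mono) auto
    finally show ?thesis using N sq by linarith
  next
    case 2
    have "4 * real m * 1 \<le> 22 * m * sqrt p" using m1 sq by (intro mult_mono) auto
    then show ?thesis using N 2 by linarith
  next
    case 3
    \<comment> \<open>The order of vanishing is \<open>2 * t\<close>. The excess \<open>20 * m\<close> of \<open>J\<close> over half of it pays for the
      degrees \<open>k * m\<close> of the derivatives, which sum up to about \<open>m * p\<close>. That \<open>p\<close> is at least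
      \<open>16\<^sup>2\<close> gives \<open>16 * t \<le> p\<close>, so that the terms of size \<open>m * t\<close> are negligible.\<close>
    define t where "t = nat \<lfloor>sqrt p\<rfloor>"
    define B where "B = (p - m) div 2"
    define J where "J = t + 20 * m"
    define q where "q = (p - 1) div 2"
    have pq: "p = 2 * q + 1" using p prime_odd_nat[OF p] by (auto simp: q_def elim!: oddE)
    have t: "real t \<le> sqrt p" "sqrt p < real t + 1" unfolding t_def by (auto simp: of_nat_nat)
    have "sqrt p \<ge> 16" using 3 by (intro real_le_rsqrt) simp
    then have t16: "t \<ge> 16" using t by linarith
    have "real t * real t \<le> sqrt p * sqrt p" using t by (intro mult_mono) auto
    then have tt: "t * t \<le> p" using sq by (metis of_nat_le_iff of_nat_mult)
    have t16p: "16 * t \<le> p" using mult_le_mono1[OF t16, of t] tt by linarith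
    have B: "4 * B \<ge> p" using 3 by (auto simp: B_def)
    have "2 * t * card {a \<in> {0..<int p}. int p dvd poly f a ^ q - \<epsilon>} \<le> m * (2 * t + q) + B + J * p"
    proof (rule stepanov_degree_bound[OF p(1) pq f f1 f0 m(1)])
      show "m + 2 * B \<le> p + 1" using 3 by (auto simp: B_def)
      show "2 * t \<le> p" using t16p by simp
      have a: "m * (t * t) \<le> m * p" using tt by simp
      have b: "p \<le> m * p" using m(2) by simp
      have d: "16 * (m * t) \<le> m * p" using mult_le_mono2[OF t16p, of m] by (simp add: mult_ac)
      have e: "20 * (m * p) \<le> 80 * (m * B)" using mult_le_mono2[OF B, of m] by (simp add: mult_ac)
      have "0 < m * p" using m(2) p by simp
      then have "2 * (m * (t * t)) + t * t + 20 * (m * t) < 20 * (m * B)" using a b d e tt by linarith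
      then show "2 * t * (B + 2 * t * m + J) < 2 * B * J"
        unfolding J_def by (simp add: algebra_simps)
    qed
    then have "2 * t * ?N \<le> m * (2 * t + q) + B + J * p" by (simp add: q_def)
    then have "4 * (t * ?N) \<le> 4 * (m * t) + m * (2 * q) + 2 * B + 2 * (t * p) + 40 * (m * p)"
      unfolding J_def by (simp add: algebra_simps)
    moreover have "m * (2 * q) \<le> m * p" using pq by simp
    moreover have "2 * B \<le> m * p"
    proof -
      have "2 * B \<le> 1 * p" by (simp add: B_def)
      also have "\<dots> \<le> m * p" using m(2) by (intro mult_le_mono1) simp
      finally show ?thesis .
    qed
    ultimately have "4 * (t * ?N) \<le> 4 * (m * t) + 2 * (t * p) + 42 * (m * p)" by linarith
    then have "real (4 * (t * ?N)) \<le> real (4 * (m * t) + 2 * (t * p) + 42 * (m * p))"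
      using of_nat_le_iff by blast
    then have "4 * (real t * ?N) \<le> 4 * (real m * t) + 2 * (real t * p) + 42 * (real m * p)" by simp
    moreover have "real m * real p \<le> real m * (2 * real t * sqrt p)"
    proof -
      have "sqrt p \<le> 2 * real t" using t t16 by linarith
      then have "sqrt p * sqrt p \<le> 2 * real t * sqrt p" by (intro mult_right_mono) auto
      then show ?thesis using sq by (intro mult_left_mono) auto
    qed
    ultimately have "real t * (4 * real ?N) \<le> real t * (4 * m + 2 * p + 84 * (m * sqrt p))"
      by (simp add: algebra_simps)
    then have "4 * real ?N \<le> 4 * m + 2 * p + 84 * (m * sqrt p)"
      using t16 by (subst (asm) mult_le_cancel_left_pos) auto
    moreover have "real m * 1 \<le> m * sqrt p" using sq by (intro mult_left_mono) auto
    ultimately show ?thesis by linarith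
  qed
qed

section \<open>Character sums\<close>

lemma Legendre_cases: "Legendre a p = 0 \<or> Legendre a p = 1 \<or> Legendre a p = -1"
  by (simp add: Legendre_def)

lemma prod_signs_cases:
  assumes "finite A" "\<And>a. a \<in> A \<Longrightarrow> g a = 0 \<or> g a = 1 \<or> g a = (-1::int)"
  shows "(\<Prod>a\<in>A. g a) = 0 \<or> (\<Prod>a\<in>A. g a) = 1 \<or> (\<Prod>a\<in>A. g a) = -1"
  using assms
proof (induction A rule: finite_induct)
  case empty
  show ?case by simp
next
  case (insert x A)
  then have "g x = 0 \<or> g x = 1 \<or> g x = -1"
    and "prod g A = 0 \<or> prod g A = 1 \<or> prod g A = -1" by blast+
  then show ?case using insert.hyps by auto
qed

lemma prime_dvd_prod_int_iff:
  assumes "prime p" "finite A"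
  shows "int p dvd (\<Prod>a\<in>A. g a) \<longleftrightarrow> (\<exists>a\<in>A. int p dvd g a)"
  using assms by (simp add: prime_dvd_prod_iff)

text \<open>
  By Euler's criterion the product of Legendre symbols is \<open>f(n) ^ ((p - 1) div 2)\<close> modulo \<open>p\<close> for
  \<open>f = (\<Prod>a\<in>A. X + a)\<close>. Both values \<open>1\<close> and \<open>-1\<close> are taken at most about \<open>p / 2\<close> times and
  together at least \<open>p - card A\<close> times, so each is taken about \<open>p / 2\<close> times. Shifts in
  \<open>{1..<p}\<close> make the constant coefficient of \<open>f\<close> a unit modulo \<open>p\<close> and its roots simple.
\<close>

lemma Legendre_product_sum_bound:
  assumes p: "prime p" "p > 2" and A: "A \<subseteq> {1..<p}" "A \<noteq> {}"
  shows "\<bar>real_of_int (\<Sum>n<p. \<Prod>a\<in>A. Legendre (int n + int a) (int p))\<bar> \<le> 45 * card A * sqrt p"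
proof -
  have finA: "finite A" using A(1) finite_subset by blast
  define F where "F n = (\<Prod>a\<in>A. Legendre (int n + int a) (int p))" for n
  define f where "f = (\<Prod>a\<in>A. [:int a, 1:])"
  define q where "q = (p - 1) div 2"
  have poly_f: "poly f x = (\<Prod>a\<in>A. x + int a)" for x
    by (simp add: f_def poly_prod add.commute)
  have Ff: "[F n = poly f (int n) ^ q] (mod int p)" for n
    unfolding F_def poly_f prod_power_distrib q_def
    by (intro cong_prod euler_criterion p)
  have F_cases: "F n = 0 \<or> F n = 1 \<or> F n = -1" for n
    unfolding F_def by (intro prod_signs_cases finA Legendre_cases)
  obtain \<alpha> where \<alpha>: "\<alpha> \<in> A" using A(2) by blast
  define f1 where "f1 = (\<Prod>a\<in>A - {\<alpha>}. [:int a, 1:])"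
  have f: "f = [:-(- int \<alpha>), 1:] * f1"
    unfolding f_def f1_def using \<alpha> finA by (simp add: prod.remove del: mult_pCons_left)
  have small: "\<not> int p dvd k" if "0 < \<bar>k\<bar>" "\<bar>k\<bar> < int p" for k
    using that by (metis zdvd_not_zless dvd_abs_iff)
  have f1: "\<not> int p dvd poly f1 (- int \<alpha>)"
  proof -
    have "\<not> int p dvd int a - int \<alpha>" if "a \<in> A - {\<alpha>}" for a
      using that subsetD[OF A(1), of a] subsetD[OF A(1) \<alpha>] by (intro small) auto
    then show ?thesis
      unfolding f1_def poly_prod using finA
      by (subst prime_dvd_prod_int_iff[OF p(1)]) auto
  qed
  have "\<not> int p dvd 0 + int a" if "a \<in> A" for a
    using subsetD[OF A(1) that] by (intro small) auto
  then have "\<not> int p dvd poly f 0"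
    unfolding poly_f using finA by (subst prime_dvd_prod_int_iff[OF p(1)]) auto
  then have f0: "\<not> int p dvd coeff f 0" by (simp add: poly_0_coeff_0)
  have deg: "degree f = card A"
    unfolding f_def by (subst degree_prod_sum_eq) auto
  have cA: "card A > 0" using A(2) finA by (simp add: card_gt_0_iff)

  have N: "real (card {n \<in> {..<p}. F n = \<epsilon>}) \<le> p / 2 + 22 * card A * sqrt p" for \<epsilon>
  proof -
    have "card {n \<in> {..<p}. F n = \<epsilon>} = card (int ` {n \<in> {..<p}. F n = \<epsilon>})"
      by (simp add: card_image)
    also have "\<dots> \<le> card {a \<in> {0..<int p}. int p dvd poly f a ^ q - \<epsilon>}"
    proof (rule card_mono)
      show "finite {a \<in> {0..<int p}. int p dvd poly f a ^ q - \<epsilon>}"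
        by (rule finite_subset[of _ "{0..<int p}"]) auto
      show "int ` {n \<in> {..<p}. F n = \<epsilon>} \<subseteq> {a \<in> {0..<int p}. int p dvd poly f a ^ q - \<epsilon>}"
        using Ff by (auto simp: cong_iff_dvd_diff dvd_diff_commute)
    qed
    finally show ?thesis
      using power_residue_count_le[OF p f f1 f0 deg cA, of \<epsilon>] unfolding q_def by linarith
  qed
  \<comment> \<open>A zero \<open>n < p\<close> satisfies \<open>n + a = p\<close> for some shift \<open>a\<close>.\<close>
  have zeros: "card {n \<in> {..<p}. F n = 0} \<le> card A"
  proof -
    have "{n \<in> {..<p}. F n = 0} \<subseteq> (\<lambda>a. p - a) ` A"
    proof
      fix n assume n: "n \<in> {n \<in> {..<p}. F n = 0}"
      then obtain a where a: "a \<in> A" "Legendre (int n + int a) (int p) = 0"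
        unfolding F_def using finA by (auto simp: prod_zero_iff)
      then have "[int n + int a = 0] (mod int p)" by (auto simp: Legendre_def split: if_splits)
      then have "int p dvd int (n + a)" by (simp add: cong_0_iff)
      then have "p dvd n + a" by (simp only: int_dvd_int_iff)
      then obtain k where k: "n + a = p * k" by (elim dvdE)
      have "0 < n + a" "n + a < p * 2" using n a(1) A(1) by auto
      then have "k = 1" unfolding k by (cases k; cases "k - 1") auto
      then have "n = p - a" using k by simp
      then show "n \<in> (\<lambda>a. p - a) ` A" using a(1) by blast
    qed
    then show ?thesis using finA by (meson card_image_le card_mono finite_imageI le_trans)
  qed
  have "of_bool (F n = 1) + of_bool (F n = -1) + of_bool (F n = 0) = (1::real)" for n
    using F_cases[of n] by auto
  then have "real p = (\<Sum>n<p. of_bool (F n = 1) + of_bool (F n = -1) + of_bool (F n = 0))"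
    by simp
  also have "\<dots> = real (card {n \<in> {..<p}. F n = 1}) + card {n \<in> {..<p}. F n = -1} + card {n \<in> {..<p}. F n = 0}"
    by (simp add: sum.distrib Int_def)
  finally have total: "real p = \<dots>" .
  have "real_of_int (\<Sum>n<p. F n) = (\<Sum>n<p. of_bool (F n = 1) - of_bool (F n = -1))"
    unfolding of_int_sum
  proof (intro sum.cong refl)
    fix n show "real_of_int (F n) = of_bool (F n = 1) - of_bool (F n = -1)"
      using F_cases[of n] by auto
  qed
  also have "\<dots> = real (card {n \<in> {..<p}. F n = 1}) - card {n \<in> {..<p}. F n = -1}"
    by (simp add: sum_subtractf Int_def)
  finally have diff: "real_of_int (\<Sum>n<p. F n) = \<dots>" .
  define E where "E = real (card A) * sqrt p"
  have "real (card {n \<in> {..<p}. F n = 0}) \<le> E"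
    using zeros p mult_left_mono[of 1 "sqrt p" "real (card A)"] by (simp add: E_def)
  moreover have "real (card {n \<in> {..<p}. F n = 1}) \<le> p / 2 + 22 * E"
      "real (card {n \<in> {..<p}. F n = -1}) \<le> p / 2 + 22 * E"
    using N[of 1] N[of "-1"] by (simp_all add: E_def)
  ultimately have "\<bar>real_of_int (\<Sum>n<p. F n)\<bar> \<le> 45 * E"
    unfolding diff abs_le_iff using total by (intro conjI) linarith+
  then show ?thesis by (simp add: F_def E_def)
qed

section \<open>Occurrences of a word of residues and nonresidues\<close>

primrec occurs :: "int set \<Rightarrow> int \<Rightarrow> bool list \<Rightarrow> bool" where
  "occurs R a [] \<longleftrightarrow> True"
| "occurs R a (b # w) \<longleftrightarrow> (a \<in> R \<longleftrightarrow> b) \<and> occurs R (a + 1) w"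

lemma occurs_iff_nth: "occurs R a w \<longleftrightarrow> (\<forall>j<length w. a + int j \<in> R \<longleftrightarrow> w ! j)"
proof (induction w arbitrary: a)
  case Nil
  show ?case by simp
next
  case (Cons b w)
  have "(\<forall>j<Suc (length w). a + int j \<in> R \<longleftrightarrow> (b # w) ! j)
     \<longleftrightarrow> (a \<in> R \<longleftrightarrow> b) \<and> (\<forall>j<length w. a + 1 + int j \<in> R \<longleftrightarrow> w ! j)"
    by (auto simp: All_less_Suc2 add_ac)
  then show ?case using Cons by simp
qed

lemma occurs_append: "occurs R a (v @ w) \<longleftrightarrow> occurs R a v \<and> occurs R (a + int (length v)) w"
  by (induction v arbitrary: a) (auto simp: add_ac)

lemma occurs_replicate_False: "occurs R a (replicate k False) \<longleftrightarrow> (\<forall>j<k. a + int j \<notin> R)"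
  by (auto simp: occurs_iff_nth)

text \<open>
  The first letter is placed at \<open>n + 1\<close>, so that the shifts that occur are the positive numbers
  \<open>1, \<dots>, length w\<close>, as the character sum estimate requires.
\<close>

definition residue_word_count :: "nat \<Rightarrow> bool list \<Rightarrow> nat" where
  "residue_word_count p w = card {n. n + length w < p \<and> occurs (quad_residues p) (int n + 1) w}"

lemma Legendre_eq_quad_residue:
  assumes "0 < n" "n < p"
  shows "Legendre (int n) (int p) = (if int n \<in> quad_residues p then 1 else -1)"
proof -
  have "\<not> [int n = 0] (mod int p)"
    using assms by (simp add: cong_0_iff nat_dvd_not_less)
  then show ?thesis using assms by (auto simp: Legendre_def quad_residues_def)
qed

text \<open>
  The indicator of a prescribed residue character is \<open>(1 \<plusminus> \<chi>(n)) / 2\<close>. The product of these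
  indicators over the letters of the word expands into \<open>2 ^ length w\<close> products of Legendre symbols,
  each with weight \<open>1 / 2 ^ length w\<close>. The empty product gives the main term; the sums
  of the others are bounded by the Weil-type estimate. Positions where the word runs past \<open>p\<close>
  number at most \<open>length w\<close>.
\<close>

lemma residue_word_count_bound:
  assumes p: "prime p" "p > 2" and w: "w \<noteq> []"
  shows "\<bar>real (residue_word_count p w) - p / 2 ^ length w\<bar> \<le> 46 * length w * sqrt p"
proof -
  define W where "W = length w"
  have sq: "sqrt p \<ge> 1" using p by simp
  have Wsq: "real W \<le> W * sqrt p"
    using mult_left_mono[OF sq, of "real W"] by simp
  show ?thesis
  proof (cases "W < p")
    case False
    then have "residue_word_count p w = 0" by (simp add: residue_word_count_def W_def)
    moreover have "real p / 2 ^ W \<le> p"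
      using mult_left_mono[of 1 "2 ^ W" "real p"] by (simp add: divide_le_eq)
    moreover have "real p \<le> W" using False by simp
    ultimately show ?thesis using Wsq unfolding W_def[symmetric] by simp
  next
    case True
    define L where "L n = real_of_int (Legendre (int n) (int p))" for n :: nat
    define \<sigma> where "\<sigma> j = (if w ! j then 1 else -1 :: real)" for j
    define G where "G n = (\<Prod>j<W. (1 + \<sigma> j * L (n + Suc j)) / 2)" for n
    have L_cases: "L n = 0 \<or> L n = 1 \<or> L n = -1" for n
      unfolding L_def using Legendre_cases[of "int n" "int p"] by auto
    have factor: "0 \<le> (1 + \<sigma> j * L n) / 2" "(1 + \<sigma> j * L n) / 2 \<le> 1" for j n
      using L_cases[of n] by (auto simp: \<sigma>_def)
    have G01: "0 \<le> G n" "G n \<le> 1" for n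
      unfolding G_def using factor by (auto intro!: prod_nonneg prod_le_1)
    have G_ind: "G n = of_bool (occurs (quad_residues p) (int n + 1) w)" if n: "n + W < p" for n
    proof -
      have "(1 + \<sigma> j * L (n + Suc j)) / 2 = of_bool (int n + 1 + int j \<in> quad_residues p \<longleftrightarrow> w ! j)"
        if "j < W" for j
      proof -
        have "L (n + Suc j) = (if int n + 1 + int j \<in> quad_residues p then 1 else -1)"
          unfolding L_def using n that Legendre_eq_quad_residue[of "n + Suc j" p] by (simp add: add_ac)
        then show ?thesis by (simp add: \<sigma>_def)
      qed
      then have "G n = (\<Prod>j<W. of_bool (int n + 1 + int j \<in> quad_residues p \<longleftrightarrow> w ! j))"
        unfolding G_def by (intro prod.cong refl) simp
      also have "\<dots> = of_bool (occurs (quad_residues p) (int n + 1) w)"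
        unfolding occurs_iff_nth W_def[symmetric] by (auto simp: prod_zero_iff)
      finally show ?thesis .
    qed
    have "{n. n + W < p \<and> occurs (quad_residues p) (int n + 1) w}
        = {..<p - W} \<inter> {n. occurs (quad_residues p) (int n + 1) w}" by auto
    then have "real (residue_word_count p w) = (\<Sum>n<p - W. G n)"
      unfolding residue_word_count_def W_def[symmetric] by (simp add: G_ind)
    moreover have "(\<Sum>n<p. G n) = (\<Sum>n<p - W. G n) + (\<Sum>n\<in>{p - W..<p}. G n)"
    proof -
      have "{..<p} = {..<p - W} \<union> {p - W..<p}" by auto
      then show ?thesis by (simp add: sum.union_disjoint ivl_disj_int)
    qed
    moreover have "0 \<le> (\<Sum>n\<in>{p - W..<p}. G n)" by (intro sum_nonneg G01)
    moreover have "(\<Sum>n\<in>{p - W..<p}. G n) \<le> W"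
      using sum_bounded_above[of "{p - W..<p}" G 1] G01 True by simp
    ultimately have cnt: "\<bar>real (residue_word_count p w) - (\<Sum>n<p. G n)\<bar> \<le> W" by simp

    define T where "T X = (\<Sum>n<p. \<Prod>j\<in>X. L (n + Suc j))" for X
    have T: "\<bar>T X\<bar> \<le> 45 * W * sqrt p" if X: "X \<subseteq> {..<W}" "X \<noteq> {}" for X
    proof -
      have "T X = real_of_int (\<Sum>n<p. \<Prod>a\<in>Suc ` X. Legendre (int n + int a) (int p))"
        unfolding T_def L_def of_int_sum of_int_prod
        by (intro sum.cong refl) (subst prod.reindex, auto simp: add_ac)
      moreover have "Suc ` X \<subseteq> {1..<p}" using X(1) True by auto
      ultimately have "\<bar>T X\<bar> \<le> 45 * card (Suc ` X) * sqrt p"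
        using Legendre_product_sum_bound[OF p, of "Suc ` X"] X(2) by simp
      moreover have "card (Suc ` X) \<le> W"
        using card_mono[OF _ X(1)] by (simp add: card_image)
      ultimately show ?thesis
        by (meson mult_le_mono2 mult_right_mono of_nat_le_iff of_nat_0_le_iff order_trans real_sqrt_ge_zero)
    qed
    have "(\<Sum>n<p. G n) = (\<Sum>n<p. (\<Sum>X\<in>Pow {..<W}. (\<Prod>j\<in>X. \<sigma> j * L (n + Suc j))) / 2 ^ W)"
      unfolding G_def prod_dividef
      by (subst add.commute, subst prod_add) simp_all
    also have "\<dots> = (\<Sum>X\<in>Pow {..<W}. (\<Prod>j\<in>X. \<sigma> j) * T X) / 2 ^ W"
      unfolding T_def sum_divide_distrib[symmetric] prod.distrib sum_distrib_left
      by (subst sum.swap) simp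
    also have "(\<Sum>X\<in>Pow {..<W}. (\<Prod>j\<in>X. \<sigma> j) * T X)
        = p + (\<Sum>X\<in>Pow {..<W} - {{}}. (\<Prod>j\<in>X. \<sigma> j) * T X)"
      by (subst sum.remove[of _ "{}"]) (auto simp: T_def)
    finally have G: "(\<Sum>n<p. G n) - p / 2 ^ W
        = (\<Sum>X\<in>Pow {..<W} - {{}}. (\<Prod>j\<in>X. \<sigma> j) * T X) / 2 ^ W"
      by (simp add: add_divide_distrib)
    have "\<bar>\<Sum>X\<in>Pow {..<W} - {{}}. (\<Prod>j\<in>X. \<sigma> j) * T X\<bar>
        \<le> (\<Sum>X\<in>Pow {..<W} - {{}}. \<bar>(\<Prod>j\<in>X. \<sigma> j) * T X\<bar>)" by (rule sum_abs)
    also have "\<dots> \<le> (\<Sum>X\<in>Pow {..<W} - {{}}. 45 * W * sqrt p)"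
    proof (rule sum_mono)
      fix X assume "X \<in> Pow {..<W} - {{}}"
      then have "\<bar>T X\<bar> \<le> 45 * W * sqrt p" using T by auto
      moreover have "\<bar>\<Prod>j\<in>X. \<sigma> j\<bar> = 1" by (simp add: abs_prod \<sigma>_def if_distrib prod.neutral)
      ultimately show "\<bar>(\<Prod>j\<in>X. \<sigma> j) * T X\<bar> \<le> 45 * W * sqrt p" by (simp add: abs_mult)
    qed
    also have "\<dots> = (2 ^ W - 1) * (45 * W * sqrt p)"
      by (simp add: card_Diff_singleton card_Pow of_nat_diff)
    also have "\<dots> \<le> 2 ^ W * (45 * W * sqrt p)" by (intro mult_right_mono) auto
    finally have "\<bar>(\<Sum>n<p. G n) - p / 2 ^ W\<bar> \<le> 45 * W * sqrt p"
      unfolding G by (simp add: abs_divide divide_le_eq mult_ac)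
    then show ?thesis using cnt Wsq unfolding W_def[symmetric] by linarith
  qed
qed

section \<open>Gaps between consecutive residues\<close>

text \<open>
  The residue pattern of a stretch that starts at a residue and in which consecutive residues have
  the distances \<open>ds\<close>; the final letter is the residue that ends the last gap.
\<close>

definition gap_word :: "nat list \<Rightarrow> bool list" where
  "gap_word ds = concat (map (\<lambda>d. True # replicate (d - 1) False) ds) @ [True]"

lemma gap_word_simps [simp]:
  "gap_word [] = [True]"
  "gap_word (d # ds) = True # replicate (d - 1) False @ gap_word ds"
  by (simp_all add: gap_word_def)

lemma gap_word_hd: "\<exists>w. gap_word ds = True # w"
  by (cases ds) simp_all

lemma gap_word_last: "gap_word ds \<noteq> [] \<and> last (gap_word ds) = True"
  by (simp add: gap_word_def)

lemma length_gap_word: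
  assumes "\<And>d. d \<in> set ds \<Longrightarrow> d \<ge> 1"
  shows "length (gap_word ds) = 1 + sum_list ds"
  using assms
proof (induction ds)
  case (Cons d ds)
  then have "d \<ge> 1" "length (gap_word ds) = 1 + sum_list ds" by simp_all
  then show ?case by simp
qed simp

locale increasing_enumeration =
  fixes R :: "int set" and q :: "nat \<Rightarrow> int" and N :: nat
  assumes range: "R = q ` {..<N}"
    and less: "m < n \<Longrightarrow> n < N \<Longrightarrow> q m < q n"
begin

lemma less_iff: "m < N \<Longrightarrow> n < N \<Longrightarrow> q m < q n \<longleftrightarrow> m < n"
  using less by (metis less_asym' linorder_neqE_nat order_less_irrefl)

lemma in_range: "n < N \<Longrightarrow> q n \<in> R"
  using range by blast

lemma not_between:
  assumes "Suc n < N" "q n < a" "a < q (Suc n)"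
  shows "a \<notin> R"
proof
  assume "a \<in> R"
  then obtain m where "m < N" "a = q m" using range by blast
  then show False using assms less_iff[of n m] less_iff[of m "Suc n"] by simp
qed

lemma next_iff:
  assumes n: "n < N" and d: "d \<ge> 1"
  shows "Suc n < N \<and> q (Suc n) = q n + int d \<longleftrightarrow>
    q n + int d \<in> R \<and> (\<forall>j<d - 1. q n + 1 + int j \<notin> R)"
proof
  assume l: "Suc n < N \<and> q (Suc n) = q n + int d"
  then have "q n + int d \<in> R" using in_range by metis
  moreover have "q n + 1 + int j \<notin> R" if "j < d - 1" for j
    using l that by (intro not_between) auto
  ultimately show "q n + int d \<in> R \<and> (\<forall>j<d - 1. q n + 1 + int j \<notin> R)" by blast
next
  assume r: "q n + int d \<in> R \<and> (\<forall>j<d - 1. q n + 1 + int j \<notin> R)"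
  then obtain m where m: "m < N" "q m = q n + int d" using range by auto
  have "n < m" using less_iff[OF n m(1)] m(2) d by simp
  then have sn: "Suc n < N" "Suc n \<le> m" using m(1) by simp_all
  have up: "q (Suc n) \<le> q n + int d"
    using less_iff[OF m(1) sn(1)] sn(2) m(2) by (metis leI not_less)
  have low: "q n < q (Suc n)" using less sn by simp
  have "q (Suc n) = q n + int d"
  proof (rule ccontr)
    assume "q (Suc n) \<noteq> q n + int d"
    then have "nat (q (Suc n) - q n - 1) < d - 1" using up low by linarith
    then have "q n + 1 + int (nat (q (Suc n) - q n - 1)) \<notin> R" using r by blast
    then show False using low in_range[OF sn(1)] by simp
  qed
  then show "Suc n < N \<and> q (Suc n) = q n + int d" using sn by simp
qed

lemma gaps_iff_occurs:
  assumes "n < N" "\<And>d. d \<in> set ds \<Longrightarrow> d \<ge> 1"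
  shows "n + length ds < N \<and> (\<forall>i<length ds. q (n + i + 1) = q (n + i) + int (ds ! i)) \<longleftrightarrow>
    occurs R (q n) (gap_word ds)"
  using assms
proof (induction ds arbitrary: n)
  case Nil
  then show ?case using in_range by simp
next
  case (Cons d ds)
  have d: "d \<ge> 1" using Cons.prems(2) by simp
  obtain w where w: "gap_word ds = True # w" using gap_word_hd by blast
  have "occurs R (q n) (gap_word (d # ds)) \<longleftrightarrow>
     (\<forall>j<d - 1. q n + 1 + int j \<notin> R) \<and> occurs R (q n + int d) (gap_word ds)"
    using in_range[OF Cons.prems(1)] d
    by (simp add: occurs_append occurs_replicate_False of_nat_diff)
  also have "\<dots> \<longleftrightarrow> Suc n < N \<and> q (Suc n) = q n + int d \<and> occurs R (q (Suc n)) (gap_word ds)"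
    using next_iff[OF Cons.prems(1) d] unfolding w by auto
  also have "\<dots> \<longleftrightarrow> q (Suc n) = q n + int d \<and> Suc n + length ds < N \<and>
      (\<forall>i<length ds. q (Suc n + i + 1) = q (Suc n + i) + int (ds ! i))"
    using Cons.IH[of "Suc n"] Cons.prems(2) by auto
  also have "\<dots> \<longleftrightarrow> n + length (d # ds) < N \<and>
      (\<forall>i<length (d # ds). q (n + i + 1) = q (n + i) + int ((d # ds) ! i))"
    by (auto simp: All_less_Suc2)
  finally show ?case by blast
qed

lemma long_gap_occurs:
  assumes "Suc n < N" "q (Suc n) > q n + int K"
  shows "occurs R (q n) (True # replicate K False)"
proof -
  have "q n + 1 + int j \<notin> R" if "j < K" for j
    using assms(2) that by (intro not_between[OF assms(1)]) auto
  then show ?thesis using assms(1) in_range[of n] by (simp add: occurs_replicate_False)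
qed

end

lemma finite_quad_residues: "finite (quad_residues p)"
  by (rule finite_subset[of _ "{1..int p - 1}"]) (auto simp: quad_residues_def)

text \<open>
  The squares of \<open>1, \<dots>, (p - 1) div 2\<close> represent each residue class once, as \<open>b\<close> and \<open>-b\<close> have
  the same square.
\<close>

lemma card_quad_residues:
  assumes p: "prime p" "p > 2"
  shows "card (quad_residues p) = (p - 1) div 2"
proof -
  define h where "h = (p - 1) div 2"
  have ph: "p = 2 * h + 1" using p prime_odd_nat[OF p] by (auto simp: h_def elim!: oddE)
  have pint: "prime (int p)" using p by simp
  let ?s = "\<lambda>b. (b * b) mod int p"
  have small: "\<not> int p dvd k" if "0 < k" "k < int p" for k
    using that zdvd_not_zless by blast
  have "inj_on ?s {1..int h}"
  proof (rule inj_onI)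
    fix b c assume b: "b \<in> {1..int h}" and c: "c \<in> {1..int h}" and "?s b = ?s c"
    then have "int p dvd (b + c) * (b - c)"
      by (simp add: mod_eq_dvd_iff algebra_simps)
    moreover have "\<not> int p dvd b + c" using b c ph by (intro small) auto
    ultimately have "int p dvd b - c" using pint by (metis prime_dvd_mult_iff)
    moreover have "\<bar>b - c\<bar> < int p" using b c ph by auto
    ultimately show "b = c" by (metis dvd_imp_le_int eq_iff_diff_eq_0 abs_of_nat not_less)
  qed
  moreover have "?s ` {1..int h} = quad_residues p"
  proof
    show "?s ` {1..int h} \<subseteq> quad_residues p"
    proof
      fix a assume "a \<in> ?s ` {1..int h}"
      then obtain b where b: "b \<in> {1..int h}" "a = ?s b" by blast
      have "\<not> int p dvd b" using b ph by (intro small) auto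
      then have "\<not> int p dvd b * b" using pint by (simp add: prime_dvd_mult_iff)
      then have "a \<noteq> 0" using b(2) by (auto simp: dvd_eq_mod_eq_0)
      moreover have "0 \<le> a" "a < int p" using b(2) p by auto
      moreover have "[b\<^sup>2 = a] (mod int p)" using b(2) by (simp add: cong_def power2_eq_square)
      ultimately show "a \<in> quad_residues p"
        unfolding quad_residues_def QuadRes_def by auto
    qed
    show "quad_residues p \<subseteq> ?s ` {1..int h}"
    proof
      fix a assume "a \<in> quad_residues p"
      then obtain y where a: "1 \<le> a" "a \<le> int p - 1" and y: "[y\<^sup>2 = a] (mod int p)"
        unfolding quad_residues_def QuadRes_def by auto
      define b where "b = y mod int p"
      have b: "0 \<le> b" "b < int p" using p by (simp_all add: b_def)
      have sb: "?s b = a"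
        using y a by (simp add: b_def cong_def power2_eq_square mod_mult_eq)
      have "b \<noteq> 0" using sb a by auto
      show "a \<in> ?s ` {1..int h}"
      proof (cases "b \<le> int h")
        case True
        then show ?thesis using sb b \<open>b \<noteq> 0\<close> by (intro image_eqI[of _ _ b]) auto
      next
        case False
        have "(int p - b) * (int p - b) = b * b + int p * (int p - 2 * b)"
          by (simp add: algebra_simps)
        then have "?s (int p - b) = a" using sb by simp
        then show ?thesis
          using b False ph by (intro image_eqI[of _ _ "int p - b"]) auto
      qed
    qed
  qed
  ultimately show ?thesis using card_image[of ?s "{1..int h}"] by (simp add: h_def)
qed

lemma quad_residues_enumeration:
  assumes "prime p" "p > 2"
  shows "increasing_enumeration (quad_residues p) (qr p) ((p - 1) div 2)"
proof
  let ?l = "sorted_list_of_set (quad_residues p)"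
  have len: "length ?l = (p - 1) div 2"
    using card_quad_residues[OF assms] by simp
  have "quad_residues p = set ?l" using finite_quad_residues by simp
  also have "\<dots> = (!) ?l ` {..<length ?l}" by (auto simp: set_conv_nth)
  also have "(!) ?l = qr p" by (simp add: qr_def fun_eq_iff)
  finally show "quad_residues p = qr p ` {..<(p - 1) div 2}" unfolding len .
  fix m n assume "m < n" "n < (p - 1) div 2"
  then show "qr p m < qr p n"
    unfolding qr_def using len
    by (intro sorted_wrt_nth_less[OF strict_sorted_list_of_set]) simp_all
qed

lemma qr_bounds:
  assumes "prime p" "p > 2" "n < (p - 1) div 2"
  shows "1 \<le> qr p n" "qr p n < int p"
  using increasing_enumeration.in_range[OF quad_residues_enumeration[OF assms(1,2)] assms(3)]
  by (auto simp: quad_residues_def)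

text \<open>
  The indices \<open>n\<close> correspond to the positions \<open>qr p n - 1\<close>. Conversely, an occurrence of the word
  starts at a residue, because its first letter is \<open>True\<close>, and stays below \<open>p\<close>, because its last letter is.
\<close>

lemma card_gaps_eq_word_count:
  assumes p: "prime p" "p > 2" and ds: "\<And>d. d \<in> set ds \<Longrightarrow> d \<ge> 1"
  shows "card {n. n + length ds < (p - 1) div 2 \<and>
        (\<forall>i<length ds. qr p (n + i + 1) = qr p (n + i) + int (ds ! i))}
      = residue_word_count p (gap_word ds)" (is "card ?A = _")
proof -
  interpret increasing_enumeration "quad_residues p" "qr p" "(p - 1) div 2"
    by (rule quad_residues_enumeration[OF p])
  let ?B = "{n. n + length (gap_word ds) < p \<and> occurs (quad_residues p) (int n + 1) (gap_word ds)}"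
  have A: "n \<in> ?A \<longleftrightarrow> n < (p - 1) div 2 \<and> occurs (quad_residues p) (qr p n) (gap_word ds)" for n
    using gaps_iff_occurs[of n ds] ds by auto
  have "bij_betw (\<lambda>n. nat (qr p n - 1)) ?A ?B"
  proof (rule bij_betw_imageI)
    show "inj_on (\<lambda>n. nat (qr p n - 1)) ?A"
    proof (rule inj_onI)
      fix m n assume "m \<in> ?A" "n \<in> ?A" and eq: "nat (qr p m - 1) = nat (qr p n - 1)"
      then have mn: "m < (p - 1) div 2" "n < (p - 1) div 2" unfolding A by auto
      then have "qr p m = qr p n" using eq qr_bounds[OF p mn(1)] qr_bounds[OF p mn(2)] by linarith
      then show "m = n" using less_iff[OF mn] less_iff[OF mn(2,1)] by simp
    qed
    show "(\<lambda>n. nat (qr p n - 1)) ` ?A = ?B"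
    proof (intro equalityI subsetI)
      fix k assume "k \<in> (\<lambda>n. nat (qr p n - 1)) ` ?A"
      then obtain n where "n \<in> ?A" and k: "k = nat (qr p n - 1)" by blast
      then have n: "n < (p - 1) div 2" "occurs (quad_residues p) (qr p n) (gap_word ds)"
        unfolding A by blast+
      have k1: "int k + 1 = qr p n" using k qr_bounds[OF p n(1)] by simp
      let ?W = "length (gap_word ds)"
      have W: "?W > 0" "gap_word ds ! (?W - 1)"
        using gap_word_last[of ds] by (auto simp: last_conv_nth)
      then have "qr p n + int (?W - 1) \<in> quad_residues p"
        using n(2) unfolding occurs_iff_nth by auto
      then have "k + ?W < p" using k1 W(1) by (auto simp: quad_residues_def)
      then show "k \<in> ?B" using n(2) k1 by simp
    next
      fix k assume k: "k \<in> ?B"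
      then have "int k + 1 \<in> quad_residues p" using gap_word_hd[of ds] by auto
      then obtain n where n: "n < (p - 1) div 2" "int k + 1 = qr p n" using range by auto
      then have "n \<in> ?A" using k unfolding A by simp
      moreover have "k = nat (qr p n - 1)" using n(2) by linarith
      ultimately show "k \<in> (\<lambda>n. nat (qr p n - 1)) ` ?A" by blast
    qed
  qed
  then show ?thesis unfolding residue_word_count_def by (rule bij_betw_same_card)
qed

lemma card_long_gaps_le_word_count:
  assumes p: "prime p" "p > 2"
  shows "card {n. Suc n < (p - 1) div 2 \<and> qr p (Suc n) > qr p n + int K}
    \<le> residue_word_count p (True # replicate K False)" (is "card ?A \<le> _")
proof -
  interpret increasing_enumeration "quad_residues p" "qr p" "(p - 1) div 2"
    by (rule quad_residues_enumeration[OF p])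
  let ?w = "True # replicate K False"
  let ?B = "{n. n + length ?w < p \<and> occurs (quad_residues p) (int n + 1) ?w}"
  have "card ((\<lambda>n. nat (qr p n - 1)) ` ?A) \<le> card ?B"
  proof (rule card_mono)
    show "finite ?B" by (rule finite_subset[of _ "{..<p}"]) auto
    show "(\<lambda>n. nat (qr p n - 1)) ` ?A \<subseteq> ?B"
    proof
      fix k assume "k \<in> (\<lambda>n. nat (qr p n - 1)) ` ?A"
      then obtain n where n: "Suc n < (p - 1) div 2" "qr p (Suc n) > qr p n + int K"
        and k: "k = nat (qr p n - 1)" by auto
      have k1: "int k + 1 = qr p n" using k qr_bounds[OF p, of n] n(1) by simp
      have "k + length ?w < p" using k1 n qr_bounds[OF p n(1)] by simp
      moreover have "occurs (quad_residues p) (int k + 1) ?w"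
        unfolding k1 by (rule long_gap_occurs[OF n])
      ultimately show "k \<in> ?B" by blast
    qed
  qed
  moreover have "inj_on (\<lambda>n. nat (qr p n - 1)) ?A"
  proof (rule inj_onI)
    fix m n assume "m \<in> ?A" "n \<in> ?A" and eq: "nat (qr p m - 1) = nat (qr p n - 1)"
    then have mn: "m < (p - 1) div 2" "n < (p - 1) div 2" by auto
    then have "qr p m = qr p n" using eq qr_bounds[OF p mn(1)] qr_bounds[OF p mn(2)] by linarith
    then show "m = n" using less_iff[OF mn] less_iff[OF mn(2,1)] by simp
  qed
  ultimately show ?thesis unfolding residue_word_count_def by (simp add: card_image)
qed

section \<open>Counting patterns\<close>

text \<open>
  The gaps up to \<open>K\<close> that are compatible with the letter \<open>b\<close> of a pattern.
\<close>

definition gap_range :: "nat \<Rightarrow> nat \<Rightarrow> nat set" where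
  "gap_range K b = (if b = 1 then {1} else {2..K})"

lemma finite_gap_range [simp]: "finite (gap_range K b)"
  by (simp add: gap_range_def)

lemma card_gap_range_le: "K \<ge> 1 \<Longrightarrow> card (gap_range K b) \<le> K"
  by (simp add: gap_range_def)

lemma gap_range_bounds: "K \<ge> 1 \<Longrightarrow> d \<in> gap_range K b \<Longrightarrow> 1 \<le> d \<and> d \<le> K"
  by (auto simp: gap_range_def split: if_splits)

lemma sum_gap_weights:
  assumes "K \<ge> 1"
  shows "(\<Sum>d\<in>gap_range K b. (1/2) ^ d) = (if b = 1 then 1/2 else 1/2 - (1/2) ^ K :: real)"
proof -
  have "(\<Sum>d\<in>{2..K}. (1/2) ^ d) = (1/2 - (1/2) ^ K :: real)"
    using assms
  proof (induction K rule: dec_induct)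
    case (step n)
    then have "{2..Suc n} = insert (Suc n) {2..n}" by auto
    then show ?case using step by simp
  qed simp
  then show ?thesis by (simp add: gap_range_def)
qed

text \<open>
  Without the bound \<open>K\<close> on the gaps, both letters would have total weight \<open>1 / 2\<close>, the letter
  \<open>0\<close> because \<open>1/4 + 1/8 + \<dots> = 1/2\<close>.
\<close>

lemma gap_weights_product_bound:
  assumes K: "K \<ge> 1"
  shows "\<bar>(\<Prod>i<s. \<Sum>d\<in>gap_range K (x i). (1/2) ^ d) - (1/2) ^ s\<bar> \<le> real s * (1/2) ^ K"
proof -
  let ?z = "\<lambda>i. \<Sum>d\<in>gap_range K (x i). (1/2::real) ^ d"
  have pw: "(1/2::real) ^ K \<le> 1/2" "(1/2::real) ^ K \<ge> 0"
    using power_decreasing[OF K, of "1/2::real"] by simp_all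
  have z: "norm (?z i) \<le> 1" "norm (?z i - 1/2) \<le> (1/2) ^ K" for i
    unfolding sum_gap_weights[OF K] real_norm_def using pw by (simp_all only: split: if_split) linarith+
  have "norm ((\<Prod>i<s. ?z i) - (\<Prod>i<s. 1/2)) \<le> (\<Sum>i<s. norm (?z i - 1/2))"
    by (rule norm_prod_diff) (use z in auto)
  also have "\<dots> \<le> (\<Sum>i<s. (1/2) ^ K)" by (intro sum_mono z)
  finally show ?thesis by simp
qed

text \<open>
  Here the pattern does not wrap around the end of the period.
\<close>

definition pattern_positions :: "nat \<Rightarrow> nat \<Rightarrow> (nat \<Rightarrow> nat) \<Rightarrow> nat set" where
  "pattern_positions p s x = {n. n + s < (p - 1) div 2 \<and> (\<forall>i<s. qr_seq p (n + i) = x i)}"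

lemma pattern_count_near_card_positions:
  assumes p: "prime p" "p \<ge> 5" and s: "s \<ge> 1"
  shows "card (pattern_positions p s x) \<le> pattern_count p s x"
    "pattern_count p s x \<le> card (pattern_positions p s x) + s"
proof -
  define N where "N = (p - 1) div 2"
  have odd: "odd p" using p prime_odd_nat by auto
  have N: "n \<le> (p - 5) div 2 \<longleftrightarrow> n + 1 < N" for n
    using odd p(2) by (auto simp: N_def elim!: oddE)
  let ?A = "{n. n \<le> (p - 5) div 2 \<and> (\<forall>i<s. qr_seq p (n + i) = x i)}"
  have finA: "finite ?A" by (rule finite_subset[of _ "{..(p - 5) div 2}"]) auto
  have sub: "pattern_positions p s x \<subseteq> ?A"
    using s unfolding pattern_positions_def N N_def[symmetric] by auto
  \<comment> \<open>Only the last \<open>s\<close> start indices can lead beyond the last residue.\<close>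
  have "?A \<subseteq> pattern_positions p s x \<union> {N - s..<N}"
    unfolding pattern_positions_def N N_def[symmetric] by auto
  then have "card ?A \<le> card (pattern_positions p s x \<union> {N - s..<N})"
    using finite_subset[OF sub finA] by (intro card_mono) auto
  also have "\<dots> \<le> card (pattern_positions p s x) + card {N - s..<N}" by (rule card_Un_le)
  also have "card {N - s..<N} \<le> s" by simp
  finally show "pattern_count p s x \<le> card (pattern_positions p s x) + s"
    by (simp add: pattern_count_def)
  show "card (pattern_positions p s x) \<le> pattern_count p s x"
    unfolding pattern_count_def by (rule card_mono[OF finA sub])
qed

text \<open>
  Positions are sorted by the sequence \<open>g\<close> of their next \<open>s\<close> gaps. Those with all gaps at most \<open>K\<close>
  are counted exactly by the words of the admissible \<open>g\<close>; any other position is followed, within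
  \<open>s\<close> steps, by a residue after which \<open>K\<close> consecutive nonresidues come.
\<close>

lemma card_positions_near_word_sum:
  fixes p s K :: nat and x :: "nat \<Rightarrow> nat"
  assumes p: "prime p" "p \<ge> 5" and x: "\<And>i. i < s \<Longrightarrow> x i \<in> {0, 1}" and K: "K \<ge> 1"
  defines "D \<equiv> PiE {..<s} (\<lambda>i. gap_range K (x i))"
  shows "(\<Sum>g\<in>D. residue_word_count p (gap_word (map g [0..<s]))) \<le> card (pattern_positions p s x)"
    and "card (pattern_positions p s x) \<le>
      (\<Sum>g\<in>D. residue_word_count p (gap_word (map g [0..<s])))
        + s * residue_word_count p (True # replicate K False)"
proof -
  define N where "N = (p - 1) div 2"
  have p2: "p > 2" using p by simp
  interpret increasing_enumeration "quad_residues p" "qr p" N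
    unfolding N_def by (rule quad_residues_enumeration[OF p(1) p2])
  define A where "A g = {n. n + s < N \<and> (\<forall>i<s. qr p (n + i + 1) = qr p (n + i) + int (g i))}" for g
  have finD: "finite D" unfolding D_def by (intro finite_PiE) auto
  have finA: "finite (A g)" for g
    by (rule finite_subset[of _ "{..<N}"]) (auto simp: A_def)
  have finP: "finite (pattern_positions p s x)"
    by (rule finite_subset[of _ "{..<N}"]) (auto simp: pattern_positions_def N_def)
  have g1: "1 \<le> g i" "g i \<le> K" "g i \<in> gap_range K (x i)" if "g \<in> D" "i < s" for g i
    using that gap_range_bounds[OF K, of "g i" "x i"] by (auto simp: D_def PiE_iff)
  have cardA: "card (A g) = residue_word_count p (gap_word (map g [0..<s]))" if g: "g \<in> D" for g
  proof -
    have "A g = {n. n + length (map g [0..<s]) < (p - 1) div 2 \<and>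
        (\<forall>i<length (map g [0..<s]). qr p (n + i + 1) = qr p (n + i) + int (map g [0..<s] ! i))}"
      by (simp add: A_def N_def)
    then show ?thesis
      using g1[OF g] by (simp only:, intro card_gaps_eq_word_count[OF p(1) p2]) auto
  qed
  have "A g \<inter> A g' = {}" if "g \<in> D" "g' \<in> D" "g \<noteq> g'" for g g'
  proof -
    have "\<exists>i<s. g i \<noteq> g' i"
    proof (rule ccontr)
      assume "\<not> (\<exists>i<s. g i \<noteq> g' i)"
      then have "g = g'" by (intro PiE_ext[OF that(1,2)[unfolded D_def]]) auto
      then show False using that(3) by blast
    qed
    then obtain i where i: "i < s" "g i \<noteq> g' i" by blast
    show ?thesis
    proof (intro equals0I)
      fix n assume "n \<in> A g \<inter> A g'"
      then have "int (g i) = int (g' i)" using i(1) unfolding A_def by fastforce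
      then show False using i(2) by simp
    qed
  qed
  then have card_UN: "card (\<Union>g\<in>D. A g) = (\<Sum>g\<in>D. residue_word_count p (gap_word (map g [0..<s])))"
    using finD finA cardA by (subst card_UN_disjoint) auto
  have seq: "qr_seq p m = (if qr p (m + 1) = qr p m + 1 then 1 else 0)" if "m + 1 < N" for m
  proof -
    have "m < (p - 3) div 2" using that by (simp add: N_def)
    then show ?thesis by (simp add: qr_seq_def)
  qed
  have "(\<Union>g\<in>D. A g) \<subseteq> pattern_positions p s x"
  proof
    fix n assume "n \<in> (\<Union>g\<in>D. A g)"
    then obtain g where g: "g \<in> D" "n \<in> A g" by blast
    have "qr_seq p (n + i) = x i" if i: "i < s" for i
    proof -
      have "qr p (n + i + 1) = qr p (n + i) + int (g i)" "n + i + 1 < N"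
        using g(2) i by (auto simp: A_def)
      then have "qr_seq p (n + i) = (if g i = 1 then 1 else 0)" by (simp add: seq)
      then show ?thesis using g1(3)[OF g(1) i] x[OF i] by (auto simp: gap_range_def)
    qed
    then show "n \<in> pattern_positions p s x"
      using g(2) by (simp add: pattern_positions_def A_def N_def)
  qed
  from card_mono[OF finP this]
  show "(\<Sum>g\<in>D. residue_word_count p (gap_word (map g [0..<s]))) \<le> card (pattern_positions p s x)"
    unfolding card_UN .

  define T where "T = {m. Suc m < N \<and> qr p (Suc m) > qr p m + int K}"
  have finT: "finite T" by (rule finite_subset[of _ "{..<N}"]) (auto simp: T_def)
  define S where "S i = {n. n + i \<in> T}" for i
  have S: "finite (S i)" "card (S i) \<le> card T" for i
  proof -
    have "S i \<subseteq> T \<union> {..<N}" by (auto simp: S_def T_def)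
    then show "finite (S i)" using finT by (meson finite_Un finite_lessThan finite_subset)
    have "card ((\<lambda>n. n + i) ` S i) \<le> card T" using finT by (intro card_mono) (auto simp: S_def)
    then show "card (S i) \<le> card T" by (simp add: card_image)
  qed
  have "pattern_positions p s x \<subseteq> (\<Union>g\<in>D. A g) \<union> (\<Union>i<s. S i)"
  proof
    fix n assume n: "n \<in> pattern_positions p s x"
    then have ns: "n + s < N" and t: "\<And>i. i < s \<Longrightarrow> qr_seq p (n + i) = x i"
      by (auto simp: pattern_positions_def N_def)
    show "n \<in> (\<Union>g\<in>D. A g) \<union> (\<Union>i<s. S i)"
    proof (cases "\<exists>i<s. n + i \<in> T")
      case True
      then show ?thesis by (auto simp: S_def)
    next
      case False
      define g where "g = restrict (\<lambda>i. nat (qr p (n + i + 1) - qr p (n + i))) {..<s}"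
      have step: "qr p (n + i + 1) = qr p (n + i) + int (g i) \<and> g i \<in> gap_range K (x i)" if i: "i < s" for i
      proof -
        have lt: "n + i + 1 < N" using i ns by simp
        have inc: "qr p (n + i) < qr p (n + i + 1)" using less[of "n + i" "n + i + 1"] lt by simp
        have le: "qr p (n + i + 1) \<le> qr p (n + i) + int K" using False i lt by (auto simp: T_def)
        have gi: "int (g i) = qr p (n + i + 1) - qr p (n + i)" using inc i by (simp add: g_def)
        have "x i = (if g i = 1 then 1 else 0)"
          using t[OF i] seq[OF lt] gi by auto
        moreover have "1 \<le> g i" "g i \<le> K" using gi inc le by linarith+
        ultimately show ?thesis using gi by (auto simp: gap_range_def)
      qed
      then have "g \<in> D" unfolding D_def by (auto simp: g_def)
      moreover have "n \<in> A g" using step ns by (simp add: A_def)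
      ultimately show ?thesis by blast
    qed
  qed
  then have "card (pattern_positions p s x) \<le> card ((\<Union>g\<in>D. A g) \<union> (\<Union>i<s. S i))"
    using finD finA S(1) by (intro card_mono) auto
  also have "\<dots> \<le> card (\<Union>g\<in>D. A g) + card (\<Union>i<s. S i)" by (rule card_Un_le)
  also have "card (\<Union>i<s. S i) \<le> (\<Sum>i<s. card (S i))" by (rule card_UN_le) simp
  also have "(\<Sum>i<s. card (S i)) \<le> s * card T" using sum_bounded_above[of "{..<s}" "\<lambda>i. card (S i)" "card T"] S(2) by simp
  also have "card T \<le> residue_word_count p (True # replicate K False)"
    unfolding T_def N_def by (rule card_long_gaps_le_word_count[OF p(1) p2])
  finally show "card (pattern_positions p s x) \<le>
      (\<Sum>g\<in>D. residue_word_count p (gap_word (map g [0..<s])))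
        + s * residue_word_count p (True # replicate K False)"
    unfolding card_UN by simp
qed

text \<open>
  The word of \<open>g\<close> has length \<open>1 + (\<Sum>i<s. g i)\<close>, so the main terms \<open>p / 2 ^ length\<close> sum to \<open>p / 2\<close>
  times a product over \<open>i\<close>. There are at most \<open>K ^ s\<close> words, all of length at most \<open>2 * s * K\<close>,
  which accounts for the error \<open>s * K ^ (s + 1) * sqrt p\<close>.
\<close>

lemma word_sum_near_main_term:
  fixes p s K :: nat and x :: "nat \<Rightarrow> nat"
  assumes p: "prime p" "p > 2" and s: "s \<ge> 1" and K: "K \<ge> 1"
  defines "D \<equiv> PiE {..<s} (\<lambda>i. gap_range K (x i))"
  shows "\<bar>(\<Sum>g\<in>D. real (residue_word_count p (gap_word (map g [0..<s])))) - p / 2 ^ (s + 1)\<bar>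
    \<le> 92 * (s * K ^ (s + 1)) * sqrt p + p * (real s * (1/2) ^ K) / 2"
proof -
  have g1: "1 \<le> g i" "g i \<le> K" if "g \<in> D" "i < s" for g i
    using that gap_range_bounds[OF K, of "g i" "x i"] by (auto simp: D_def PiE_iff)
  let ?w = "\<lambda>g. gap_word (map g [0..<s])"
  have len: "length (?w g) = 1 + (\<Sum>i<s. g i)" if "g \<in> D" for g
    using g1[OF that] by (subst length_gap_word) (auto simp: interv_sum_list_conv_sum_set_nat atLeast0LessThan)
  have err: "\<bar>real (residue_word_count p (?w g)) - p / 2 ^ length (?w g)\<bar> \<le> 92 * (s * K) * sqrt p"
    if g: "g \<in> D" for g
  proof -
    define k where "k = s * K"
    have "(\<Sum>i<s. g i) \<le> k"
      using sum_bounded_above[of "{..<s}" g K] g1[OF g] by (simp add: k_def)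
    moreover have "1 \<le> k" using s K by (simp add: k_def)
    ultimately have "length (?w g) \<le> 2 * k" unfolding len[OF g] by simp
    then have "46 * length (?w g) \<le> 92 * (s * K)" by (simp add: k_def mult.commute)
    then have "real (46 * length (?w g)) * sqrt p \<le> real (92 * (s * K)) * sqrt p"
      by (intro mult_right_mono) (simp_all only: of_nat_le_iff real_sqrt_ge_0_iff of_nat_0_le_iff)
    moreover have "?w g \<noteq> []" using len[OF g] by auto
    ultimately show ?thesis using residue_word_count_bound[OF p, of "?w g"] by linarith
  qed
  have "card D \<le> K ^ s"
    unfolding D_def using prod_mono[of "{..<s}" "\<lambda>i. card (gap_range K (x i))" "\<lambda>_. K"] K
    by (simp add: card_PiE card_gap_range_le)
  have "\<bar>(\<Sum>g\<in>D. real (residue_word_count p (?w g))) - (\<Sum>g\<in>D. p / 2 ^ length (?w g))\<bar>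
      \<le> (\<Sum>g\<in>D. \<bar>real (residue_word_count p (?w g)) - p / 2 ^ length (?w g)\<bar>)"
    unfolding sum_subtractf[symmetric] by (rule sum_abs)
  also have "\<dots> \<le> (\<Sum>g\<in>D. 92 * (s * K) * sqrt p)" by (intro sum_mono err)
  also have "\<dots> = real (card D) * (92 * (s * K) * sqrt p)" by simp
  also have "\<dots> \<le> real (K ^ s) * (92 * (s * K) * sqrt p)"
    using \<open>card D \<le> K ^ s\<close> by (intro mult_right_mono) (simp_all only: of_nat_le_iff, simp)
  also have "\<dots> = 92 * (s * K ^ (s + 1)) * sqrt p" by simp
  finally have 1: "\<bar>(\<Sum>g\<in>D. real (residue_word_count p (?w g))) - (\<Sum>g\<in>D. p / 2 ^ length (?w g))\<bar>
      \<le> 92 * (s * K ^ (s + 1)) * sqrt p" .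
  have "(\<Sum>g\<in>D. p / 2 ^ length (?w g)) = (\<Sum>g\<in>D. p / 2 * (\<Prod>i<s. (1/2) ^ g i))"
    by (intro sum.cong refl) (simp add: len power_sum power_one_over prod_dividef)
  also have "\<dots> = p / 2 * (\<Prod>i<s. \<Sum>d\<in>gap_range K (x i). (1/2) ^ d)"
    unfolding D_def by (subst prod_sum_PiE) (simp_all add: sum_distrib_left)
  finally have "(\<Sum>g\<in>D. p / 2 ^ length (?w g)) - p / 2 ^ (s + 1)
      = p / 2 * ((\<Prod>i<s. \<Sum>d\<in>gap_range K (x i). (1/2) ^ d) - (1/2) ^ s)"
    by (simp add: right_diff_distrib power_one_over)
  then have "\<bar>(\<Sum>g\<in>D. p / 2 ^ length (?w g)) - p / 2 ^ (s + 1)\<bar>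
      = p / 2 * \<bar>(\<Prod>i<s. \<Sum>d\<in>gap_range K (x i). (1/2) ^ d) - (1/2) ^ s\<bar>"
    by (simp only: abs_mult abs_divide abs_of_nat abs_numeral)
  also have "\<dots> \<le> p / 2 * (real s * (1/2) ^ K)"
    by (intro mult_left_mono gap_weights_product_bound K) simp
  also have "\<dots> = p * (real s * (1/2) ^ K) / 2" by simp
  finally show ?thesis using 1 by linarith
qed

text \<open>
  The truncation \<open>K = \<lfloor>ln p\<rfloor>\<close> fits both errors: \<open>K \<le> ln p\<close> keeps the number of words below
  \<open>ln p ^ s\<close>, so that no constant to the power \<open>s\<close> is lost, and since \<open>e \<le> 4\<close> the number
  \<open>2 ^ K\<close> is still at least half the square root of \<open>p\<close>, so that gaps longer than \<open>K\<close> are rare.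
\<close>

theorem theorem3:
  shows "\<exists>c::real. c > 0 \<and>
    (\<forall>(p::nat) (s::nat) (x::nat \<Rightarrow> nat).
       prime p \<longrightarrow> p \<ge> 5 \<longrightarrow> s \<ge> 1 \<longrightarrow> (\<forall>i<s. x i \<in> {0, 1}) \<longrightarrow>
       \<bar>real (pattern_count p s x) - real p / 2 ^ (s + 1)\<bar>
         \<le> c * (real s * sqrt (real p) * ln (real p) ^ (s + 1)))"
proof (intro exI[of _ 187] conjI allI impI)
  fix p s :: nat and x :: "nat \<Rightarrow> nat"
  assume p: "prime p" "p \<ge> 5" and s: "s \<ge> 1" and x: "\<forall>i<s. x i \<in> {0, 1}"
  have p2: "p > 2" using p(2) by simp
  define L where "L = ln (real p)"
  define K where "K = nat \<lfloor>L\<rfloor>"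
  define r where "r = sqrt (real p)"
  have rr: "r * r = p" "r \<ge> 1" using p(2) by (simp_all add: r_def)
  have "exp 1 \<le> real p" using exp_le p(2) by linarith
  then have L1: "L \<ge> 1" unfolding L_def using p(2) by (subst ln_ge_iff) auto
  then have K1: "K \<ge> 1" and KL: "real K \<le> L" "L \<le> real K + 1"
    by (auto simp: K_def le_nat_iff of_nat_nat)
  have LL: "L \<le> L ^ (s + 1)" "1 \<le> L ^ (s + 1)" "real K ^ (s + 1) \<le> L ^ (s + 1)"
    using L1 KL by (auto intro: self_le_power one_le_power power_mono simp del: power_Suc)
  \<comment> \<open>From \<open>p \<le> exp (K + 1) \<le> 4 ^ (K + 1)\<close>.\<close>
  have half: "p * (1/2) ^ K \<le> 2 * r"
  proof -
    have "real p = exp L" using p(2) by (simp add: L_def)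
    also have "\<dots> \<le> exp (real (K + 1))" using KL by simp
    also have "\<dots> = exp 1 ^ (K + 1)" by (simp only: mult_1_right flip: exp_of_nat_mult)
    also have "\<dots> \<le> 4 ^ (K + 1)" using exp_le by (intro power_mono) auto
    also have "\<dots> = (2 ^ (K + 1))\<^sup>2" by (simp add: power2_eq_square flip: power_mult_distrib)
    finally have "r \<le> 2 ^ (K + 1)" unfolding r_def by (intro real_le_lsqrt) auto
    then have "r * r \<le> r * 2 ^ (K + 1)" using rr by (intro mult_left_mono) auto
    then show ?thesis using rr by (simp add: power_one_over divide_le_eq mult_ac)
  qed
  define Z where "Z = real s * (r * L ^ (s + 1))"
  have Zr: "real s * r \<le> Z" unfolding Z_def using LL rr by (intro mult_left_mono) auto
  have Zs: "real s \<le> Z" using Zr rr mult_left_mono[of 1 r "real s"] by simp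
  have ZL: "real s * (L * r) \<le> Z"
    unfolding Z_def using LL rr mult_right_mono[of L "L ^ (s + 1)" r] by (intro mult_left_mono) (auto simp: mult_ac)
  have ZK: "real s * real K ^ (s + 1) * r \<le> Z"
  proof -
    have "real s * (real K ^ (s + 1) * r) \<le> real s * (L ^ (s + 1) * r)"
      using LL(3) rr(2) by (intro mult_left_mono mult_right_mono) auto
    then show ?thesis by (simp only: Z_def mult_ac)
  qed

  let ?D = "PiE {..<s} (\<lambda>i. gap_range K (x i))"
  let ?M = "\<Sum>g\<in>?D. residue_word_count p (gap_word (map g [0..<s]))"
  let ?t = "residue_word_count p (True # replicate K False)"
  have xi: "x i \<in> {0, 1}" if "i < s" for i using x that by blast
  have "pattern_count p s x \<ge> ?M" "pattern_count p s x \<le> ?M + s * ?t + s"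
    using pattern_count_near_card_positions[OF p s, of x]
      card_positions_near_word_sum[of p s x K, OF p xi K1] by linarith+
  then have count: "real (pattern_count p s x) \<ge> real ?M"
      "real (pattern_count p s x) \<le> real ?M + real s * real ?t + real s"
    by (simp_all only: of_nat_le_iff flip: of_nat_mult of_nat_add)
  have "\<bar>real ?t - p / 2 ^ (K + 1)\<bar> \<le> 46 * (real K + 1) * r"
    using residue_word_count_bound[OF p(1) p2, of "True # replicate K False"]
    by (simp add: r_def add_ac)
  then have "real ?t \<le> p / 2 ^ (K + 1) + 46 * (real K + 1) * r" by linarith
  also have "p / 2 ^ (K + 1) \<le> r" using half by (simp add: power_one_over)
  also have "46 * (real K + 1) * r \<le> 92 * (L * r)"
    using KL L1 rr mult_right_mono[of "real K + 1" "2 * L" r] by simp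
  finally have "real s * real ?t \<le> real s * (r + 92 * (L * r))" by (intro mult_left_mono) simp_all
  also have "\<dots> \<le> Z + 92 * Z" using Zr ZL by (simp add: distrib_left)
  finally have tail: "real s * real ?t \<le> 93 * Z" by simp
  have "\<bar>real ?M - p / 2 ^ (s + 1)\<bar> \<le> 92 * (s * K ^ (s + 1)) * r + p * (real s * (1/2) ^ K) / 2"
    using word_sum_near_main_term[OF p(1) p2 s K1, of x] by (simp add: r_def)
  moreover have "92 * (s * K ^ (s + 1)) * r \<le> 92 * Z" using ZK by simp
  moreover have "p * (real s * (1/2) ^ K) / 2 \<le> Z"
    using mult_left_mono[OF half, of "real s"] Zr by (simp add: mult_ac)
  ultimately have "\<bar>real ?M - p / 2 ^ (s + 1)\<bar> \<le> 93 * Z" by linarith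
  then have "\<bar>real (pattern_count p s x) - p / 2 ^ (s + 1)\<bar> \<le> 187 * Z"
    using count tail Zs by linarith
  then show "\<bar>real (pattern_count p s x) - real p / 2 ^ (s + 1)\<bar>
      \<le> 187 * (real s * sqrt (real p) * ln (real p) ^ (s + 1))"
    by (simp add: Z_def r_def L_def mult_ac)
qed simp

end
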